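(* Let $q$ be a prime number and let $N,d\in\mathbb{N}$ with $N,d\ge 2$. For $\boldsymbol{f}=(f_1,\ldots,f_d)\in(\overline{\mathbb{Z}}_q((t^{-1})))^d$ let $\mathcal{P}_N(\boldsymbol{f})=\{\boldsymbol{x}_1,\ldots,\boldsymbol{x}_N\}\subset[0,1)^d$ with $\boldsymbol{x}_n=\phi(\{t^{n-1}\boldsymbol{f}\})=(\phi(\{t^{n-1}f_1\}),\ldots,\phi(\{t^{n-1}f_d\}))$ for $n=1,\ldots,N$. Then for every $\varepsilon\in(0,1)$ there is a quantity $C(q,\varepsilon)>0$ such that $$D_N^*(\mathcal{P}_N(\boldsymbol{f}))\le C(q,\varepsilon)\sqrt{\frac{d\log d}{N}}$$ holds with probability at least $1-\varepsilon$ with respect to $\mu_d$ (i.e. the set of $\boldsymbol{f}$ satisfying this inequality has $\mu_d$-measure at least $1-\varepsilon$). The quantity $C(q,\varepsilon)$ is of order $C(q,\varepsilon)\asymp\log\varepsilon^{-1}$.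
   Context: $\mathbb{Z}_q=\{0,\ldots,q-1\}$ is the finite field of prime order $q$. $\mathbb{Z}_q((t^{-1}))$ is the field of formal Laurent series $g=\sum_{i=w}^\infty g_it^{-i}$ ($w\in\mathbb{Z}$, $g_i\in\mathbb{Z}_q$); it contains $\mathbb{Z}_q[t]$. The fractional part is $\{g\}=\sum_{i=\max(1,w)}^\infty g_it^{-i}$, and $\overline{\mathbb{Z}}_q((t^{-1}))=\{\{g\}: g\in\mathbb{Z}_q((t^{-1}))\}$ is the set of series $\sum_{i\ge1}g_it^{-i}$. The map $\phi:\overline{\mathbb{Z}}_q((t^{-1}))\to[0,1)$ is $\sum_{i\ge1}g_it^{-i}\mapsto\sum_{i\ge1}g_iq^{-i}$; $\{\cdot\}$ and $\phi$ act componentwise on vectors, and the product $t^{n-1}f_j$ is taken in $\mathbb{Z}_q((t^{-1}))$. $\mu$ is the normalized Haar measure on $\overline{\mathbb{Z}}_q((t^{-1}))$ (the cylinder set of series with prescribed first $m$ coefficients has measure $q^{-m}$), and $\mu_d$ is the $d$-fold product measure on $(\overline{\mathbb{Z}}_q((t^{-1})))^d$. For an $N$-element point set $\mathcal{P}=\{\boldsymbol{x}_1,\ldots,\boldsymbol{x}_N\}\subset[0,1)^d$ the star discrepancy is $D_N^*(\mathcal{P})=\sup_{\boldsymbol{t}\in[0,1]^d}\left|\frac{A([\boldsymbol{0},\boldsymbol{t}),\mathcal{P})}{N}-\lambda([\boldsymbol{0},\boldsymbol{t}))\right|$, where $[\boldsymbol{0},\boldsymbol{t})=\prod_{j=1}^d[0,t_j)$,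 $A(J,\mathcal{P})$ is the number of $n$ with $\boldsymbol{x}_n\in J$, and $\lambda$ is Lebesgue measure. $\log$ denotes the natural logarithm. *)

theory Defs
  imports
    "HOL-Probability.Probability"
    "HOL-Library.Landau_Symbols"
    "HOL-Computational_Algebra.Formal_Laurent_Series"
    "Berlekamp_Zassenhaus.Finite_Field"
begin

section \<open>Laurent series in the inverse of the indeterminate\<close>

text \<open>
  The field of order \<open>q\<close> is \<open>'q mod_ring\<close> with \<open>'q :: prime_card\<close> and \<open>q = CARD('q)\<close>.
  The formal variable \<open>fls_X\<close> of the type \<open>'q mod_ring fls\<close> plays the role of \<open>1/t\<close>, so that
  the coefficient of \<open>1/t^i\<close> in \<open>g\<close> is \<open>fls_nth g i\<close> and the indeterminate \<open>t\<close> itself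
  is \<open>fls_X_inv\<close>.
\<close>

lift_definition fls_frac :: "'a::zero fls \<Rightarrow> 'a fls"
  is "\<lambda>g i. if 1 \<le> i then g i else 0"
  by (auto elim: eventually_mono)

definition frac_series :: "'a::zero fls set" where
  "frac_series = range fls_frac"

text \<open>On \<open>frac_series\<close> the following map is \<open>\<Sum>i\<ge>1. g\<^sub>i / t^i \<mapsto> \<Sum>i\<ge>1. g\<^sub>i / q^i\<close>,
  with \<open>g\<^sub>i\<close> on the right read as an integer in \<open>{0..<q}\<close>.
  If all but finitely many \<open>g\<^sub>i\<close> equal \<open>q - 1\<close> the expansion is not the canonical one; the
  single series with every \<open>g\<^sub>i = q - 1\<close> is mapped to \<open>1\<close>. These series form a null set.\<close>

definition frac_to_real :: "'q::prime_card mod_ring fls \<Rightarrow> real" where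
  "frac_to_real g =
     (\<Sum>i. real_of_int (to_int_mod_ring (fls_nth g (int (Suc i)))) / real CARD('q) ^ Suc i)"


section \<open>Haar measure on the fractional parts\<close>

text \<open>\<open>digit_series c\<close> is \<open>\<Sum>n. c n / t^(n+1)\<close>.\<close>

lift_definition digit_series :: "(nat \<Rightarrow> 'a::zero) \<Rightarrow> 'a fls"
  is "\<lambda>c i. if 1 \<le> i then c (nat (i - 1)) else 0"
  by auto

abbreviation digit_space :: "(nat \<Rightarrow> 'q::prime_card mod_ring) measure" where
  "digit_space \<equiv> (\<Pi>\<^sub>M _\<in>(UNIV :: nat set). measure_pmf (pmf_of_set (UNIV :: 'q mod_ring set)))"

text \<open>
  Normalized Haar measure on the compact group \<open>frac_series\<close>, on the Borel sets of the metric
  topology of \<^typ>\<open>'a fls\<close>: the law of a series with independent uniformly distributed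
  coefficients. Translation invariance and the measure of the cylinder sets are proved below.
\<close>

definition frac_haar :: "'q::prime_card mod_ring fls measure" where
  "frac_haar = distr digit_space (restrict_space borel frac_series) digit_series"

lemma frac_series_iff: "g \<in> frac_series \<longleftrightarrow> (\<forall>i<1. fls_nth g i = 0)"
proof
  assume "\<forall>i<1. fls_nth g i = 0"
  then have "g = fls_frac g"
    by (intro fls_eqI) (auto simp: fls_frac.rep_eq)
  then show "g \<in> frac_series"
    unfolding frac_series_def by blast
qed (auto simp: frac_series_def fls_frac.rep_eq)

lemma digit_series_in_frac_series [simp]: "digit_series c \<in> frac_series"
  by (simp add: frac_series_iff digit_series.rep_eq)

lemma digit_series_digits:
  assumes "g \<in> frac_series"
  shows "digit_series (\<lambda>n. fls_nth g (int (Suc n))) = g"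
  using assms by (intro fls_eqI) (auto simp: frac_series_iff digit_series.rep_eq)

lemma dist_digit_series_less:
  assumes "\<And>i. i < m \<Longrightarrow> c i = c' i"
  shows "dist (digit_series c :: 'a::group_add fls) (digit_series c') < inverse (2 ^ m)"
proof (cases "digit_series c = digit_series c'")
  case False
  let ?d = "digit_series c - digit_series c'"
  have "?d \<noteq> 0"
    using False by simp
  moreover have "fls_nth ?d i = 0" if "i < int m + 1" for i
    using that assms by (simp add: digit_series.rep_eq)
  ultimately have "int m + 1 \<le> fls_subdegree ?d"
    using fls_subdegree_geI by blast
  then have "fls_subdegree ?d \<ge> 0" "m < nat (fls_subdegree ?d)"
    by auto
  then show ?thesis
    using False by (simp add: dist_fls_def)
qed simp

lemma measurable_digit_series:
  "digit_series \<in> measurable (digit_space :: (nat \<Rightarrow> 'q::prime_card mod_ring) measure)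
     (restrict_space borel frac_series)"
proof (rule measurable_restrict_space2)
  show "digit_series \<in> borel_measurable (digit_space :: (nat \<Rightarrow> 'q mod_ring) measure)"
  proof (rule borel_measurableI)
    fix S :: "'q mod_ring fls set"
    assume "open S"
    define cyl where "cyl m w = {c :: nat \<Rightarrow> 'q mod_ring. \<forall>i<m. c i = w i}" for m w
    define W where "W m = {w \<in> {..<m} \<rightarrow>\<^sub>E UNIV. cyl m w \<subseteq> digit_series -` S}" for m :: nat
    have cyl: "cyl m w \<in> sets digit_space" for m w
    proof -
      have "Measurable.pred digit_space (\<lambda>c :: nat \<Rightarrow> 'q mod_ring. \<forall>i<m. c i = w i)"
        by measurable
      then show ?thesis
        by (simp add: pred_def cyl_def space_PiM PiE_UNIV_domain)
    qed
    have "finite (W m)" for m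
    proof (rule finite_subset)
      show "finite ({..<m} \<rightarrow>\<^sub>E (UNIV :: 'q mod_ring set))"
        by (intro finite_PiE) auto
    qed (auto simp: W_def)
    then have "(\<Union>m. \<Union>w\<in>W m. cyl m w) \<in> sets digit_space"
      using cyl by (intro sets.countable_UN sets.finite_UN) auto
    moreover have "digit_series -` S = (\<Union>m. \<Union>w\<in>W m. cyl m w)"
    proof
      show "digit_series -` S \<subseteq> (\<Union>m. \<Union>w\<in>W m. cyl m w)"
      proof
        fix c
        assume "c \<in> digit_series -` S"
        with \<open>open S\<close> obtain r where r: "r > 0" "\<And>y. dist y (digit_series c) < r \<Longrightarrow> y \<in> S"
          unfolding open_dist by auto
        obtain m where m: "inverse (2 ^ m) < r"
          using reals_power_lt_ex[OF \<open>r > 0\<close>, of 2] by (auto simp: power_one_over inverse_eq_divide)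
        let ?w = "restrict c {..<m}"
        have "cyl m ?w \<subseteq> digit_series -` S"
          using m by (auto simp: cyl_def intro!: r less_trans[OF dist_digit_series_less])
        then have "?w \<in> W m" "c \<in> cyl m ?w"
          by (auto simp: W_def cyl_def)
        then show "c \<in> (\<Union>m. \<Union>w\<in>W m. cyl m w)"
          by blast
      qed
    qed (auto simp: W_def)
    ultimately show "digit_series -` S \<inter> space digit_space \<in> sets digit_space"
      by (simp add: space_PiM PiE_UNIV_domain)
  qed
qed simp

lemma space_frac_haar: "space (frac_haar :: 'q::prime_card mod_ring fls measure) = frac_series"
  by (simp add: frac_haar_def space_restrict_space)

lemma sets_frac_haar:
  "sets (frac_haar :: 'q::prime_card mod_ring fls measure) = sets (restrict_space borel frac_series)"
  by (simp add: frac_haar_def)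

lemma prob_space_digit_space:
  "prob_space (digit_space :: (nat \<Rightarrow> 'q::prime_card mod_ring) measure)"
  by (intro prob_space_PiM measure_pmf.prob_space_axioms)

lemma prob_space_frac_haar: "prob_space (frac_haar :: 'q::prime_card mod_ring fls measure)"
  unfolding frac_haar_def
  by (rule prob_space.prob_space_distr[OF prob_space_digit_space measurable_digit_series])

lemma borel_cylinder:
  "{g \<in> frac_series. \<forall>i\<in>{1..m}. fls_nth g (int i) = w i}
     \<in> sets (restrict_space borel (frac_series :: 'a::group_add fls set))"
proof -
  let ?P = "\<lambda>g :: 'a fls. \<forall>i\<in>{1..m}. fls_nth g (int i) = w i"
  have "open {g. ?P g}"
    unfolding open_dist
  proof (intro ballI exI[of _ "inverse (2 ^ m)"] conjI allI impI)
    fix g h :: "'a fls"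
    assume g: "g \<in> {g. ?P g}" and dist: "dist h g < inverse (2 ^ m)"
    have "fls_nth h (int i) = fls_nth g (int i)" if "i \<in> {1..m}" for i
    proof (rule ccontr)
      assume neq: "fls_nth h (int i) \<noteq> fls_nth g (int i)"
      then have "fls_nth (h - g) (int i) \<noteq> 0"
        by simp
      then have le: "fls_subdegree (h - g) \<le> int i"
        by (rule fls_subdegree_leI)
      have "inverse (2 ^ m) \<le> dist h g"
      proof (cases "fls_subdegree (h - g) \<ge> 0")
        case True
        then have "nat (fls_subdegree (h - g)) \<le> m"
          using le that by (simp add: nat_le_iff)
        then show ?thesis
          using True neq by (auto simp: dist_fls_def intro!: le_imp_inverse_le power_increasing)
      next
        case False
        have "inverse (2 ^ m) \<le> (1 :: real)"
          by (simp add: inverse_le_1_iff)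
        also have "\<dots> \<le> 2 ^ nat (- fls_subdegree (h - g))"
          by simp
        finally show ?thesis
          using False neq by (auto simp: dist_fls_def)
      qed
      with dist show False
        by simp
    qed
    with g show "h \<in> {g. ?P g}"
      by simp
  qed simp
  then have "frac_series \<inter> {g. ?P g} \<in> sets (restrict_space borel frac_series)"
    unfolding sets_restrict_space by (intro imageI borel_open)
  moreover have "frac_series \<inter> {g. ?P g} = {g \<in> frac_series. ?P g}"
    by (simp only: Int_def mem_Collect_eq)
  ultimately show ?thesis
    by (simp only:)
qed

lemma measure_frac_haar_cylinder:
  "measure frac_haar
     {g \<in> frac_series. \<forall>i\<in>{1..m}. fls_nth g (int i) = (w i :: 'q::prime_card mod_ring)}
   = 1 / real CARD('q) ^ m"
proof -
  interpret product_prob_space "\<lambda>_ :: nat. measure_pmf (pmf_of_set (UNIV :: 'q mod_ring set))" UNIV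
    by unfold_locales
  let ?A = "{g \<in> frac_series. \<forall>i\<in>{1..m}. fls_nth g (int i) = w i}"
  let ?X = "\<lambda>i :: nat. {w (Suc i)}"
  have iff: "(\<forall>i\<in>{1..m}. fls_nth (digit_series c) (int i) = w i)
      \<longleftrightarrow> (\<forall>i<m. c i = w (Suc i))" for c :: "nat \<Rightarrow> 'q mod_ring"
  proof -
    have "(\<forall>i\<in>{1..m}. fls_nth (digit_series c) (int i) = w i)
        \<longleftrightarrow> (\<forall>i\<in>Suc ` {..<m}. fls_nth (digit_series c) (int i) = w i)"
      by (simp add: image_Suc_lessThan)
    then show ?thesis
      by (auto simp: digit_series.rep_eq)
  qed
  have "digit_series -` ?A \<inter> space digit_space = {c. \<forall>i<m. c i = w (Suc i)}"
    using iff by (simp add: vimage_def space_PiM PiE_UNIV_domain)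
  also have "\<dots> = prod_emb UNIV (\<lambda>_. measure_pmf (pmf_of_set UNIV)) {..<m} (\<Pi>\<^sub>E i\<in>{..<m}. ?X i)"
    by (auto simp only: prod_emb_def space_measure_pmf PiE_UNIV_domain PiE_iff restrict_extensional
          restrict_apply lessThan_iff vimage_def Int_iff mem_Collect_eq singleton_iff Pi_UNIV UNIV_I
          if_True simp_thms ball_simps split: if_splits)
  finally have vim: "digit_series -` ?A \<inter> space digit_space = \<dots>" .
  have "measure frac_haar ?A = measure digit_space
      (prod_emb UNIV (\<lambda>_. measure_pmf (pmf_of_set UNIV)) {..<m} (\<Pi>\<^sub>E i\<in>{..<m}. ?X i))"
    unfolding frac_haar_def measure_distr[OF measurable_digit_series borel_cylinder] vim ..
  also have "\<dots> = (\<Prod>i<m. measure (measure_pmf (pmf_of_set UNIV)) (?X i))"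
    by (rule measure_PiM_emb) (simp_all only: finite_lessThan subset_UNIV sets_measure_pmf UNIV_I)
  also have "\<dots> = 1 / real CARD('q) ^ m"
  proof -
    have "measure (measure_pmf (pmf_of_set (UNIV :: 'q mod_ring set))) (?X i) = 1 / real CARD('q)" for i
      by (simp only: measure_pmf_single pmf_of_set[OF UNIV_not_empty finite]
            indicator_UNIV CARD_mod_ring)
    then show ?thesis
      by (simp only: prod_constant card_lessThan power_one_over)
  qed
  finally show ?thesis .
qed

lemma frac_haar_translation_invariant:
  assumes h: "h \<in> frac_series"
  shows "distr frac_haar frac_haar ((+) h) = (frac_haar :: 'q::prime_card mod_ring fls measure)"
proof -
  let ?U = "measure_pmf (pmf_of_set (UNIV :: 'q mod_ring set))"
  interpret product_prob_space "\<lambda>_ :: nat. ?U" UNIV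
    by unfold_locales
  define a where "a n = fls_nth h (int (Suc n))" for n
  define T where "T c = (\<lambda>n. a n + c n)" for c :: "nat \<Rightarrow> 'q mod_ring"
  have shift: "h + digit_series c = digit_series (T c)" for c
    using h by (intro fls_eqI) (auto simp: digit_series.rep_eq T_def a_def frac_series_iff)
  have T: "T \<in> measurable digit_space digit_space"
    unfolding T_def by (intro measurable_PiM_single') (auto simp: space_PiM)
  have inv: "distr digit_space digit_space T = digit_space"
  proof (rule PiM_eq)
    fix J :: "nat set" and F
    assume J: "finite J" "J \<subseteq> UNIV" "\<And>j. j \<in> J \<Longrightarrow> F j \<in> sets ?U"
    have sets: "prod_emb UNIV (\<lambda>_. ?U) J (Pi\<^sub>E J F) \<in> sets digit_space"
      using J by (intro sets_PiM_I) auto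
    have vim: "T -` prod_emb UNIV (\<lambda>_. ?U) J (Pi\<^sub>E J F) \<inter> space digit_space
        = prod_emb UNIV (\<lambda>_. ?U) J (\<Pi>\<^sub>E j\<in>J. (+) (a j) -` F j)"
      by (auto simp: prod_emb_def space_PiM PiE_UNIV_domain PiE_iff T_def)
    have *: "emeasure ?U ((+) (a j) -` F j) = emeasure ?U (F j)" for j
    proof -
      have "card ((+) (a j) -` F j) = card (F j)"
        by (rule card_vimage_inj) (auto intro: image_eqI[of _ _ "_ - a j"] simp: surj_def)
      then show ?thesis
        by (simp add: emeasure_pmf_of_set)
    qed
    show "emeasure (distr digit_space digit_space T) (prod_emb UNIV (\<lambda>_. ?U) J (Pi\<^sub>E J F))
        = (\<Prod>j\<in>J. emeasure ?U (F j))"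
      using J by (simp add: emeasure_distr[OF T sets] vim emeasure_PiM_emb *)
  qed simp
  have plus: "(+) h \<in> measurable (restrict_space borel frac_series) (restrict_space borel frac_series)"
  proof (rule measurable_restrict_space3)
    have "continuous_on UNIV ((+) h)"
    proof -
      have "dist (h + x) (h + y) = dist x y" for x y
        by (simp add: dist_fls_def)
      then show ?thesis
        unfolding continuous_on_iff by metis
    qed
    then show "(+) h \<in> borel_measurable borel"
      by (rule borel_measurable_continuous_onI)
  qed (use h in \<open>auto simp: frac_series_iff\<close>)
  have "distr frac_haar frac_haar ((+) h)
      = distr (distr digit_space (restrict_space borel frac_series) digit_series)
          (restrict_space borel frac_series) ((+) h)"
    by (intro distr_cong) (auto simp: frac_haar_def)
  also have "\<dots> = distr digit_space (restrict_space borel frac_series) (digit_series \<circ> T)"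
    by (subst distr_distr[OF plus measurable_digit_series]) (simp add: comp_def shift)
  also have "\<dots> = distr (distr digit_space digit_space T) (restrict_space borel frac_series) digit_series"
    by (rule distr_distr[OF measurable_digit_series T, symmetric])
  also have "\<dots> = frac_haar"
    by (simp add: inv frac_haar_def)
  finally show ?thesis .
qed


section \<open>Star discrepancy\<close>

definition anchored_box :: "nat \<Rightarrow> (nat \<Rightarrow> real) \<Rightarrow> (nat \<Rightarrow> real) set" where
  "anchored_box d t = (\<Pi>\<^sub>E j\<in>{1..d}. {0..<t j})"

text \<open>Points are counted with multiplicity: the \<open>N\<close>-element point set is the family
  \<open>x 1, \<dots>, x N\<close> of elements of \<open>{1..d} \<rightarrow>\<^sub>E UNIV\<close>.\<close>

definition star_discrepancy :: "nat \<Rightarrow> nat \<Rightarrow> (nat \<Rightarrow> nat \<Rightarrow> real) \<Rightarrow> real" where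
  "star_discrepancy d N x =
     (SUP t\<in>{1..d} \<rightarrow>\<^sub>E {0..1}.
        \<bar>real (card {n \<in> {1..N}. x n \<in> anchored_box d t}) / real N
          - measure (\<Pi>\<^sub>M j\<in>{1..d}. lborel) (anchored_box d t)\<bar>)"

lemma measure_anchored_box:
  assumes "t \<in> {1..d} \<rightarrow>\<^sub>E {0..1}"
  shows "measure (\<Pi>\<^sub>M j\<in>{1..d}. lborel) (anchored_box d t) = (\<Prod>j=1..d. t j)"
proof -
  interpret product_sigma_finite "\<lambda>_ :: nat. lborel :: real measure"
    by unfold_locales
  have t: "0 \<le> t j" if "j \<in> {1..d}" for j
    using assms that by (auto simp: PiE_iff)
  have "emeasure (\<Pi>\<^sub>M j\<in>{1..d}. lborel) (anchored_box d t) = (\<Prod>j=1..d. ennreal (t j))"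
    unfolding anchored_box_def using t by (subst emeasure_PiM) (auto intro!: prod.cong)
  also have "\<dots> = ennreal (\<Prod>j=1..d. t j)"
    using t by (intro prod_ennreal) auto
  finally have "emeasure (\<Pi>\<^sub>M j\<in>{1..d}. lborel) (anchored_box d t) = ennreal (\<Prod>j=1..d. t j)" .
  moreover have "0 \<le> (\<Prod>j=1..d. t j)"
    using t by (rule prod_nonneg)
  ultimately show ?thesis
    by (simp only: measure_def enn2real_ennreal)
qed


section \<open>The point set\<close>

definition kronecker_point ::
  "nat \<Rightarrow> (nat \<Rightarrow> 'q::prime_card mod_ring fls) \<Rightarrow> nat \<Rightarrow> nat \<Rightarrow> real" where
  "kronecker_point d f n = (\<lambda>j\<in>{1..d}. frac_to_real (fls_frac (fls_X_inv ^ (n - 1) * f j)))"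

end

theory Submission
  imports Defs
begin

text \<open>
  The points \<open>x n\<close> are successive shifts of one array of independent uniform digits, so their
  truncations to \<open>m\<close> digits are independent along each residue class of \<open>n\<close> modulo \<open>m\<close>, and
  counts of points in boxes of digit length \<open>m\<close> satisfy a Bernstein inequality with an extra factor
  \<open>m\<close>. Chain over levels \<open>k\<close>: a bracketing cover of the anchored boxes of width \<open>4^(-k)\<close> has
  \<open>exp (O (d k))\<close> elements of digit length \<open>m = O (k ln d)\<close>, and the increment from level \<open>k - 1\<close> to
  level \<open>k\<close> has variance \<open>O (4^(-k))\<close>. With \<open>w = sqrt (d ln d / N)\<close> the increments deviate by at
  most \<open>O (k 2^(-k) w ln (1/\<epsilon>))\<close> simultaneously, outside a set of measure \<open>\<epsilon>\<close>. The deviations sum to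
  \<open>O (w ln (1/\<epsilon>))\<close>, and the chain stops at the level where \<open>4^(-k)\<close> is about \<open>w\<close>. The factor \<open>ln d\<close>
  comes from the digit length.
\<close>

section \<open>A Bernstein inequality for block-independent sums\<close>

text \<open>The Laplace parameter \<open>l\<close> of a Bernstein bound for boxes of digit length
  \<open>m\<close> has to satisfy \<open>l * m \<le> 1\<close>. With the digit lengths used here
  this amounts to \<open>w * 4^k \<le> 1\<close>, so the chain cannot go deeper than the level at
  which \<open>4^(-k)\<close> falls to about \<open>w\<close>; the rounding error left at that level
  is itself of order \<open>w\<close>. Moreover \<open>l\<close> is chosen independently of
  \<epsilon>. The tail exponent is then linear in the threshold, and the final constant is linear in
  \<open>ln (1 / \<epsilon>)\<close>. Widths \<open>4^(-k)\<close> correspond to standard deviations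
  \<open>2^(-k)\<close>. The extra factor \<open>k\<close> in the thresholds pays both for the digit
  length and for the \<open>exp (O (d k))\<close> pairs of a level, and \<open>k / 2^k\<close> is
  still summable. Along the chain only outer corners are used; an inner corner enters at the last
  level alone, to bound the count from below.\<close>

lemma exp_le_one_plus_plus_sq:
  fixes x :: real
  assumes "\<bar>x\<bar> \<le> 1"
  shows "exp x \<le> 1 + x + x\<^sup>2"
proof (cases "x \<ge> 0")
  case True
  with assms show ?thesis
    by (intro exp_bound) auto
next
  case False
  then have x: "x \<le> 0" by simp
  \<comment> \<open>For negative \<open>x\<close> the claim is multiplied by
    \<open>exp (- x)\<close>, which dominates its quadratic Taylor polynomial. The product of the
    two polynomials is the right-hand side here, and all its terms are nonnegative.\<close>
  have "1 \<le> 1 + (x\<^sup>2 - x ^ 3 + x ^ 4) / 2"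
  proof -
    have "x ^ 3 \<le> 0"
      using x by (simp add: power3_eq_cube mult_nonneg_nonpos)
    also have "0 \<le> x\<^sup>2 + x ^ 4"
      by simp
    finally show ?thesis
      by (simp add: field_simps)
  qed
  also have "\<dots> = (1 + x + x\<^sup>2) * (1 + (- x) + (- x)\<^sup>2 / 2)"
    by (simp add: power2_eq_square power3_eq_cube power4_eq_xxxx field_simps)
  also have "\<dots> \<le> (1 + x + x\<^sup>2) * exp (- x)"
  proof (rule mult_left_mono)
    show "1 + (- x) + (- x)\<^sup>2 / 2 \<le> exp (- x)"
      using x by (intro exp_lower_Taylor_quadratic) auto
    show "0 \<le> 1 + x + x\<^sup>2"
      using assms by (auto simp: abs_le_iff intro!: add_nonneg_nonneg)
  qed
  finally show ?thesis
    by (simp add: exp_minus field_simps)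
qed

context prob_space
begin

text \<open>Centering is postponed: the quadratic bound on \<open>exp\<close> is applied to
  \<open>\<theta> * Y\<close>, and the factor \<open>exp (- (\<theta> * expectation Y))\<close> is
  multiplied in afterwards. So the raw second moment suffices, and it is \<open>Y\<close> itself
  that has to be bounded by 1.\<close>

lemma expectation_exp_centered_le:
  fixes Y :: "'a \<Rightarrow> real"
  assumes Y [measurable]: "Y \<in> borel_measurable M"
    and bound: "\<And>x. x \<in> space M \<Longrightarrow> \<bar>Y x\<bar> \<le> 1"
    and var: "expectation (\<lambda>x. (Y x)\<^sup>2) \<le> s"
    and \<theta>: "\<bar>\<theta>\<bar> \<le> 1"
  shows "expectation (\<lambda>x. exp (\<theta> * (Y x - expectation Y))) \<le> exp (\<theta>\<^sup>2 * s)"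
proof -
  have int: "integrable M Y" "integrable M (\<lambda>x. (Y x)\<^sup>2)"
    using bound by (auto intro!: integrable_const_bound[of _ 1] AE_I2 simp: abs_square_le_1)
  have \<theta>Y: "\<bar>\<theta> * Y x\<bar> \<le> 1" if "x \<in> space M" for x
    using bound[OF that] \<theta> by (simp add: abs_mult mult_le_one)
  have "expectation (\<lambda>x. exp (\<theta> * Y x)) \<le> expectation (\<lambda>x. 1 + \<theta> * Y x + (\<theta> * Y x)\<^sup>2)"
  proof (rule integral_mono)
    have "norm (exp (\<theta> * Y x)) \<le> exp 1" if "x \<in> space M" for x
      using \<theta>Y[OF that] by simp
    then show "integrable M (\<lambda>x. exp (\<theta> * Y x))"
      by (auto intro!: integrable_const_bound[of _ "exp 1"] AE_I2)
    show "integrable M (\<lambda>x. 1 + \<theta> * Y x + (\<theta> * Y x)\<^sup>2)"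
      using int by (simp add: power_mult_distrib)
    show "exp (\<theta> * Y x) \<le> 1 + \<theta> * Y x + (\<theta> * Y x)\<^sup>2" if "x \<in> space M" for x
      by (rule exp_le_one_plus_plus_sq[OF \<theta>Y[OF that]])
  qed
  also have "\<dots> = 1 + \<theta> * expectation Y + \<theta>\<^sup>2 * expectation (\<lambda>x. (Y x)\<^sup>2)"
    using int by (simp add: power_mult_distrib prob_space)
  also have "\<dots> \<le> 1 + (\<theta> * expectation Y + \<theta>\<^sup>2 * s)"
    using mult_left_mono[OF var, of "\<theta>\<^sup>2"] by simp
  also have "\<dots> \<le> exp (\<theta> * expectation Y + \<theta>\<^sup>2 * s)"
    by (rule exp_ge_add_one_self)
  finally have "expectation (\<lambda>x. exp (\<theta> * Y x)) * exp (- (\<theta> * expectation Y))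
      \<le> exp (\<theta> * expectation Y + \<theta>\<^sup>2 * s) * exp (- (\<theta> * expectation Y))"
    by (rule mult_right_mono) simp
  then show ?thesis
    by (simp add: right_diff_distrib exp_diff exp_minus exp_add field_simps)
qed

end

text \<open>\<open>n div m\<close> separates the members of a residue class and takes at most
  \<open>N div m + 1\<close> values.\<close>

lemma card_residue_class_le:
  "real (card {n \<in> {1..N::nat}. n mod m = r}) \<le> real N / real m + 1" if "m > 0"
proof -
  let ?A = "{n \<in> {1..N}. n mod m = r}"
  have "inj_on (\<lambda>n. n div m) ?A"
    by (rule inj_onI) (metis (lifting) div_mult_mod_eq mem_Collect_eq)
  then have "card ?A = card ((\<lambda>n. n div m) ` ?A)"
    by (simp add: card_image)
  also have "\<dots> \<le> card {..N div m}"
    by (intro card_mono) (auto intro: div_le_mono)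
  finally have "real (card ?A) \<le> real (N div m) + 1"
    by simp
  moreover have "real (N div m) \<le> real N / real m"
    by (rule of_nat_div_le_of_nat)
  ultimately show ?thesis
    by linarith
qed

context prob_space
begin

text \<open>The summands are independent only along residue classes modulo \<open>m\<close>; convexity of \<open>exp\<close>
  reduces the Laplace transform of the full sum to those of the classes, at the price of a
  factor \<open>m\<close> in the parameter.\<close>

lemma expectation_exp_block_sum_le:
  fixes Y :: "nat \<Rightarrow> 'a \<Rightarrow> real"
  assumes m: "m > 0"
    and Y: "\<And>n. n \<in> {1..N} \<Longrightarrow> Y n \<in> borel_measurable M"
    and bound: "\<And>n x. n \<in> {1..N} \<Longrightarrow> x \<in> space M \<Longrightarrow> \<bar>Y n x\<bar> \<le> 1"
    and mean: "\<And>n. n \<in> {1..N} \<Longrightarrow> expectation (Y n) = e"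
    and var: "\<And>n. n \<in> {1..N} \<Longrightarrow> expectation (\<lambda>x. (Y n x)\<^sup>2) \<le> s"
    and s: "0 \<le> s" "s \<le> 2"
    and indep: "\<And>r. r < m \<Longrightarrow> indep_vars (\<lambda>_. borel) Y {n \<in> {1..N}. n mod m = r}"
    and l: "l * real m \<le> 1" "0 \<le> l"
  shows "expectation (\<lambda>x. exp (l * (\<Sum>n=1..N. Y n x - e))) \<le> exp (2 + real N * real m * l\<^sup>2 * s)"
    and "integrable M (\<lambda>x. exp (l * (\<Sum>n=1..N. Y n x - e)))"
proof -
  define A where "A r = {n \<in> {1..N}. n mod m = r}" for r
  define S where "S r x = (\<Sum>n\<in>A r. Y n x - e)" for r x
  define E where "E r x = exp (l * real m * S r x)" for r x
  have A: "A r \<subseteq> {1..N}" "finite (A r)" for r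
    by (auto simp: A_def)
  have lm: "\<bar>l * real m\<bar> \<le> 1"
    using l by simp
  have e_le: "\<bar>e\<bar> \<le> 1" if "n \<in> {1..N}" for n
  proof -
    have "norm (expectation (Y n)) \<le> expectation (\<lambda>x. norm (Y n x))"
      by (rule integral_norm_bound)
    also have "\<dots> \<le> expectation (\<lambda>_. 1)"
      using Y[OF that] bound[OF that]
      by (intro integral_mono integrable_norm integrable_const_bound[of _ 1] AE_I2) auto
    finally show ?thesis
      using mean[OF that] by (simp add: prob_space)
  qed
  have E_eq: "E r x = (\<Prod>n\<in>A r. exp (l * real m * (Y n x - e)))" for r x
    by (simp add: E_def S_def sum_distrib_left exp_sum A)
  have ind: "indep_vars (\<lambda>_. borel) (\<lambda>n x. exp (l * real m * (Y n x - e))) (A r)" if "r < m" for r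
    by (rule indep_vars_compose2[OF indep[OF that, folded A_def]]) auto
  have int1: "integrable M (\<lambda>x. exp (l * real m * (Y n x - e)))" if n: "n \<in> {1..N}" for n
  proof (rule integrable_const_bound)
    have "l * real m * (Y n x - e) \<le> 1 * 2" if x: "x \<in> space M" for x
    proof -
      have "Y n x - e \<le> 2"
        using bound[OF n x] e_le[OF n] by linarith
      then have "l * real m * (Y n x - e) \<le> l * real m * 2"
        using l by (intro mult_left_mono) auto
      then show ?thesis
        using l by simp
    qed
    then show "AE x in M. norm (exp (l * real m * (Y n x - e))) \<le> exp 2"
      by (intro AE_I2) simp
    show "(\<lambda>x. exp (l * real m * (Y n x - e))) \<in> borel_measurable M"
      using Y[OF n] by simp
  qed
  have intE: "integrable M (E r)" if "r < m" for r
    unfolding E_eq by (intro indep_vars_integrable ind that int1 A(2) subsetD[OF A(1)])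
  have expE: "expectation (E r) \<le> exp (2 + real N * real m * l\<^sup>2 * s)" if r: "r < m" for r
  proof -
    have "expectation (E r) = (\<Prod>n\<in>A r. expectation (\<lambda>x. exp (l * real m * (Y n x - e))))"
      unfolding E_eq by (intro indep_vars_lebesgue_integral ind r int1 A(2) subsetD[OF A(1)])
    also have "\<dots> \<le> (\<Prod>n\<in>A r. exp ((l * real m)\<^sup>2 * s))"
    proof (rule prod_mono, safe)
      fix n assume "n \<in> A r"
      then have n: "n \<in> {1..N}"
        using A(1) by blast
      show "expectation (\<lambda>x. exp (l * real m * (Y n x - e))) \<le> exp ((l * real m)\<^sup>2 * s)"
        using expectation_exp_centered_le[OF Y[OF n] bound[OF n] var[OF n] lm] by (simp add: mean[OF n])
    qed simp
    also have "\<dots> = exp (real (card (A r)) * ((l * real m)\<^sup>2 * s))"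
      by (simp add: exp_of_nat_mult)
    also have "\<dots> \<le> exp ((real N / real m + 1) * ((l * real m)\<^sup>2 * s))"
      using card_residue_class_le[OF m, of N r] s
      by (intro iffD2[OF exp_le_cancel_iff] mult_right_mono) (auto simp: A_def)
    \<comment> \<open>The \<open>+ 1\<close> from rounding the class size costs
      \<open>(l * m)\<^sup>2 * s \<le> 2\<close>, which is the 2 in the exponent.\<close>
    also have "(real N / real m + 1) * ((l * real m)\<^sup>2 * s)
        = (l * real m)\<^sup>2 * s + real N * real m * l\<^sup>2 * s"
      using m by (simp add: field_simps power2_eq_square)
    also have "(l * real m)\<^sup>2 * s \<le> 1 * 2"
      using s lm by (intro mult_mono) (auto simp: abs_square_le_1)
    finally show ?thesis
      by simp
  qed
  have S_sum: "(\<Sum>n=1..N. Y n x - e) = (\<Sum>r<m. S r x)" for x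
  proof -
    have "{1..N} = (\<Union>r<m. A r)"
      using m by (auto simp: A_def)
    then show ?thesis
      unfolding S_def by (simp only:) (rule sum.UNION_disjoint, auto simp: A_def)
  qed
  have le: "exp (l * (\<Sum>n=1..N. Y n x - e)) \<le> (\<Sum>r<m. (1 / real m) * E r x)" for x
  proof -
    have "exp (\<Sum>r<m. (1 / real m) *\<^sub>R (l * real m * S r x)) \<le> (\<Sum>r<m. (1 / real m) * exp (l * real m * S r x))"
      using m by (intro convex_on_sum[OF _ _ exp_convex]) (auto simp: lessThan_empty_iff)
    then show ?thesis
      using m unfolding E_def S_sum by (simp add: sum_distrib_left)
  qed
  have intR: "integrable M (\<lambda>x. \<Sum>r<m. (1 / real m) * E r x)"
    using intE by auto
  show int: "integrable M (\<lambda>x. exp (l * (\<Sum>n=1..N. Y n x - e)))"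
  proof (rule Bochner_Integration.integrable_bound[OF intR])
    have "(\<lambda>x. (\<Sum>n=1..N. Y n x - e)) \<in> borel_measurable M"
      using Y by (intro borel_measurable_sum borel_measurable_diff) auto
    then show "(\<lambda>x. exp (l * (\<Sum>n=1..N. Y n x - e))) \<in> borel_measurable M"
      by simp
    have "norm (exp (l * (\<Sum>n=1..N. Y n x - e))) \<le> norm (\<Sum>r<m. (1 / real m) * E r x)" for x
      using le[of x] by simp
    then show "AE x in M. norm (exp (l * (\<Sum>n=1..N. Y n x - e))) \<le> norm (\<Sum>r<m. (1 / real m) * E r x)"
      by simp
  qed
  have "expectation (\<lambda>x. exp (l * (\<Sum>n=1..N. Y n x - e))) \<le> expectation (\<lambda>x. \<Sum>r<m. (1 / real m) * E r x)"
    by (rule integral_mono[OF int intR le])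
  also have "\<dots> = (\<Sum>r<m. (1 / real m) * expectation (E r))"
    using intE by (subst Bochner_Integration.integral_sum) auto
  also have "\<dots> \<le> (\<Sum>r<m. (1 / real m) * exp (2 + real N * real m * l\<^sup>2 * s))"
    using expE by (intro sum_mono mult_left_mono) auto
  also have "\<dots> = exp (2 + real N * real m * l\<^sup>2 * s)"
    using m by simp
  finally show "expectation (\<lambda>x. exp (l * (\<Sum>n=1..N. Y n x - e))) \<le> exp (2 + real N * real m * l\<^sup>2 * s)" .
qed

text \<open>\<open>l\<close> is left free: it is later fixed independently of \<open>T\<close>
  instead of being optimised, so that the exponent stays linear in \<open>T\<close>.\<close>

lemma block_sum_tail_bound:
  fixes Y :: "nat \<Rightarrow> 'a \<Rightarrow> real"
  assumes m: "m > 0"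
    and Y: "\<And>n. n \<in> {1..N} \<Longrightarrow> Y n \<in> borel_measurable M"
    and bound: "\<And>n x. n \<in> {1..N} \<Longrightarrow> x \<in> space M \<Longrightarrow> \<bar>Y n x\<bar> \<le> 1"
    and mean: "\<And>n. n \<in> {1..N} \<Longrightarrow> expectation (Y n) = e"
    and var: "\<And>n. n \<in> {1..N} \<Longrightarrow> expectation (\<lambda>x. (Y n x)\<^sup>2) \<le> s"
    and s: "0 \<le> s" "s \<le> 2"
    and indep: "\<And>r. r < m \<Longrightarrow> indep_vars (\<lambda>_. borel) Y {n \<in> {1..N}. n mod m = r}"
    and l: "l * real m \<le> 1" "0 < l"
  shows "prob {x \<in> space M. \<bar>(\<Sum>n=1..N. Y n x) - real N * e\<bar> \<ge> T}
    \<le> 2 * exp (2 + real N * real m * l\<^sup>2 * s - l * T)"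
proof -
  \<comment> \<open>One argument serves both tails, since all hypotheses pass from \<open>Y\<close>
    with mean \<open>e\<close> to \<open>- Y\<close> with mean \<open>- e\<close>.\<close>
  have one_sided: "prob {x \<in> space M. (\<Sum>n=1..N. Z n x - c) \<ge> T}
      \<le> exp (2 + real N * real m * l\<^sup>2 * s - l * T)"
    if Z: "(Z = Y \<and> c = e) \<or> (Z = (\<lambda>n x. - Y n x) \<and> c = - e)" for Z :: "nat \<Rightarrow> 'a \<Rightarrow> real" and c
  proof -
    have indZ: "indep_vars (\<lambda>_. borel) Z {n \<in> {1..N}. n mod m = r}" if "r < m" for r
      using Z indep[OF that] indep_vars_compose2[OF indep[OF that], of "\<lambda>_ y. - y" "\<lambda>_. borel"] by auto
    have Zs: "Z n \<in> borel_measurable M" "x \<in> space M \<Longrightarrow> \<bar>Z n x\<bar> \<le> 1" "expectation (Z n) = c"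
        "expectation (\<lambda>x. (Z n x)\<^sup>2) \<le> s" if "n \<in> {1..N}" for n x
      using Z Y[OF that] bound[OF that] mean[OF that] var[OF that] by auto
    note block = expectation_exp_block_sum_le[OF m, of N Z c s l, OF Zs s indZ l(1) less_imp_le[OF l(2)]]
    have "prob {x \<in> space M. (\<Sum>n=1..N. Z n x - c) \<ge> T}
        \<le> exp (- l * T) * (\<integral>x\<in>space M. exp (l * (\<Sum>n=1..N. Z n x - c)) \<partial>M)"
      using integrable_mult_indicator[OF sets.top block(2)] l
      by (intro Chernoff_ineq_ge) (simp_all add: set_integrable_def)
    also have "(\<integral>x\<in>space M. exp (l * (\<Sum>n=1..N. Z n x - c)) \<partial>M)
        = expectation (\<lambda>x. exp (l * (\<Sum>n=1..N. Z n x - c)))"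
      using block(2) by (rule set_integral_space)
    also have "exp (- l * T) * \<dots> \<le> exp (- l * T) * exp (2 + real N * real m * l\<^sup>2 * s)"
      using block(1) by (intro mult_left_mono) auto
    finally show ?thesis
      by (simp add: exp_add exp_diff exp_minus field_simps)
  qed
  let ?P = "{x \<in> space M. (\<Sum>n=1..N. Y n x - e) \<ge> T}"
  let ?Q = "{x \<in> space M. (\<Sum>n=1..N. - Y n x - (- e)) \<ge> T}"
  have meas: "(\<lambda>x. \<Sum>n=1..N. Y n x - e) \<in> borel_measurable M"
      "(\<lambda>x. \<Sum>n=1..N. - Y n x - (- e)) \<in> borel_measurable M"
    using Y by (auto intro!: borel_measurable_sum)
  have events: "?P \<in> events" "?Q \<in> events"
    using meas by measurable
  have "{x \<in> space M. \<bar>(\<Sum>n=1..N. Y n x) - real N * e\<bar> \<ge> T} \<subseteq> ?P \<union> ?Q"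
    by (auto simp: sum_subtractf sum_negf sum.distrib)
  then have "prob {x \<in> space M. \<bar>(\<Sum>n=1..N. Y n x) - real N * e\<bar> \<ge> T} \<le> prob (?P \<union> ?Q)"
    using events by (intro finite_measure_mono) auto
  also have "\<dots> \<le> prob ?P + prob ?Q"
    using events by (intro measure_Un_le)
  also have "prob ?P \<le> exp (2 + real N * real m * l\<^sup>2 * s - l * T)"
    by (rule one_sided) auto
  also have "prob ?Q \<le> exp (2 + real N * real m * l\<^sup>2 * s - l * T)"
    by (rule one_sided) auto
  finally show ?thesis
    by simp
qed

end

section \<open>Digit expansions\<close>

text \<open>Horner's scheme with the leading digit first: the numerator over \<open>q^m\<close> of
  the expansion truncated to \<open>m\<close> digits.\<close>

primrec digit_nat :: "nat \<Rightarrow> (nat \<Rightarrow> nat) \<Rightarrow> nat \<Rightarrow> nat" where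
  "digit_nat q u 0 = 0"
| "digit_nat q u (Suc m) = q * digit_nat q u m + u m"

lemma digit_nat_cong:
  "(\<And>i. i < m \<Longrightarrow> u i = u' i) \<Longrightarrow> digit_nat q u m = digit_nat q u' m"
  by (induction m) auto

lemma digit_nat_add_ge: "digit_nat q u m * q ^ k \<le> digit_nat q u (m + k)"
  by (induction k) (auto simp: algebra_simps intro: order_trans[OF mult_le_mono2[of _ _ q]])

lemma digit_nat_add_less:
  assumes "\<And>i. u i < q"
  shows "digit_nat q u (m + k) < (digit_nat q u m + 1) * q ^ k"
proof (induction k)
  case (Suc k)
  have "digit_nat q u (m + Suc k) < q * (digit_nat q u (m + k) + 1)"
    using assms[of "m + k"] by (simp add: algebra_simps)
  also have "\<dots> \<le> q * ((digit_nat q u m + 1) * q ^ k)"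
    using Suc by (intro mult_le_mono2) simp
  finally show ?case
    by (simp add: algebra_simps)
qed simp

lemma digit_nat_less:
  assumes "\<And>i. u i < q"
  shows "digit_nat q u m < q ^ m"
  using digit_nat_add_less[of u q 0 m] assms by simp

text \<open>Uniqueness of the base \<open>q\<close> expansion. It rewrites an event about the
  integer formed by \<open>m\<close> digits as a cylinder, whose probability follows from
  independence.\<close>

lemma digit_nat_eq_iff:
  assumes "\<And>i. i < m \<Longrightarrow> u i < q" "v < q ^ m"
  shows "digit_nat q u m = v \<longleftrightarrow> (\<forall>i<m. u i = v div q ^ (m - Suc i) mod q)"
  using assms
proof (induction m arbitrary: v)
  case (Suc m)
  then have q: "q > 0"
    by (metis gr0I less_nat_zero_code lessI)
  have v: "v div q < q ^ m"
    using Suc.prems(2) q by (simp add: less_mult_imp_div_less mult.commute)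
  have "digit_nat q u (Suc m) = v \<longleftrightarrow> digit_nat q u m = v div q \<and> u m = v mod q"
  proof
    assume "digit_nat q u (Suc m) = v"
    then have "v = digit_nat q u m * q + u m"
      by (simp add: mult.commute)
    then show "digit_nat q u m = v div q \<and> u m = v mod q"
      using Suc.prems(1)[of m] by simp
  qed (simp add: mult.commute)
  also have "digit_nat q u m = v div q \<longleftrightarrow> (\<forall>i<m. u i = v div q div q ^ (m - Suc i) mod q)"
    using Suc.prems(1) v by (intro Suc.IH) auto
  also have "(\<forall>i<m. u i = v div q div q ^ (m - Suc i) mod q) \<longleftrightarrow> (\<forall>i<m. u i = v div q ^ (Suc m - Suc i) mod q)"
  proof (intro all_cong)
    fix i assume "i < m"
    then have "Suc m - Suc i = Suc (m - Suc i)"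
      by simp
    then show "(u i = v div q div q ^ (m - Suc i) mod q) = (u i = v div q ^ (Suc m - Suc i) mod q)"
      by (simp only: power_Suc div_mult2_eq)
  qed
  finally show ?case
    by (auto simp: less_Suc_eq)
qed simp

definition digit_trunc :: "nat \<Rightarrow> (nat \<Rightarrow> nat) \<Rightarrow> nat \<Rightarrow> real" where
  "digit_trunc q u m = real (digit_nat q u m) / real q ^ m"

text \<open>\<open>B\<close> is an integer, so a numerator below \<open>B\<close> leaves at least
  one full cell of width \<open>1 / q^m\<close>, which finitely many further digits never fill;
  shorter truncations are no larger. Only the limit of the truncations may reach
  \<open>B / q^m\<close>.\<close>

lemma digit_trunc_less_grid_iff:
  assumes u: "\<And>i. u i < q"
  shows "(\<forall>k. digit_trunc q u k < real B / real q ^ m) \<longleftrightarrow> digit_nat q u m < B"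
proof -
  have q: "real q > 0"
    using u[of 0] by simp
  have le: "digit_trunc q u k < real B / real q ^ m" if B: "digit_nat q u m < B" for k
  proof (cases "k \<le> m")
    case True
    then obtain l where l: "m = k + l"
      using le_Suc_ex by blast
    have "digit_nat q u k * q ^ l < B"
      using digit_nat_add_ge[of q u k l] B l by simp
    then have "real (digit_nat q u k) * real q ^ l < real B"
      by (metis of_nat_less_iff of_nat_mult of_nat_power)
    then show ?thesis
      using q by (simp add: digit_trunc_def l power_add field_simps)
  next
    case False
    then obtain l where l: "k = m + l"
      using le_Suc_ex nat_le_linear by blast
    have "digit_nat q u k < (digit_nat q u m + 1) * q ^ l"
      unfolding l by (rule digit_nat_add_less[OF u])
    also have "\<dots> \<le> B * q ^ l"
      using B by (intro mult_le_mono1) simp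
    finally have "real (digit_nat q u k) < real B * real q ^ l"
      by (metis of_nat_less_iff of_nat_mult of_nat_power)
    then show ?thesis
      using q by (simp add: digit_trunc_def l power_add field_simps)
  qed
  have "digit_trunc q u m < real B / real q ^ m \<longleftrightarrow> digit_nat q u m < B"
    using q by (simp add: digit_trunc_def divide_less_cancel)
  then show ?thesis
    using le by blast
qed

lemma sum_digits_eq_trunc:
  assumes "q > 0"
  shows "(\<Sum>i<m. real (u i) / real q ^ Suc i) = digit_trunc q u m"
proof (induction m)
  case (Suc m)
  then show ?case
    using assms by (simp add: digit_trunc_def field_simps)
qed (simp add: digit_trunc_def)

lemma digit_expansion:
  assumes u: "\<And>i. u i < q" and q: "q \<ge> 2"
  defines "x \<equiv> (\<Sum>i. real (u i) / real q ^ Suc i)"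
  shows "digit_trunc q u m \<le> x" and summable_digits: "summable (\<lambda>i. real (u i) / real q ^ Suc i)"
proof -
  have q0: "real q > 0"
    using q by simp
  show sm: "summable (\<lambda>i. real (u i) / real q ^ Suc i)"
  proof (rule summable_comparison_test')
    show "summable (\<lambda>i. (1 / real q) ^ i)"
      using q by (intro summable_geometric) simp
    show "norm (real (u i) / real q ^ Suc i) \<le> (1 / real q) ^ i" for i
      using u[of i] q0 by (simp add: power_one_over field_simps)
  qed
  show "digit_trunc q u m \<le> x"
    using sum_le_suminf[OF sm, of "{..<m}"] q0 by (simp add: sum_digits_eq_trunc x_def del: power_Suc)
qed

section \<open>Deviations of independent uniform digits\<close>

text \<open>Abstracts the Haar measure to the law of its digits. \<open>X j i\<close> is digit
  \<open>i\<close> of coordinate \<open>j\<close>; all points read this one array, point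
  \<open>n\<close> starting at position \<open>n - 1\<close>.\<close>

locale uniform_digits = prob_space +
  fixes d q :: nat and X :: "nat \<Rightarrow> nat \<Rightarrow> 'a \<Rightarrow> nat"
  assumes q_ge_2: "q \<ge> 2"
    and digit_less: "X j i \<omega> < q"
    and digits_indep: "indep_vars (\<lambda>_. count_space UNIV) (\<lambda>p. X (fst p) (snd p)) ({1..d} \<times> UNIV)"
    and digit_uniform: "j \<in> {1..d} \<Longrightarrow> a < q \<Longrightarrow> prob {\<omega> \<in> space M. X j i \<omega> = a} = 1 / real q"
begin

text \<open>Comparing all truncations instead of the point itself makes the event exactly determined by
  the first \<open>m\<close> digits when \<open>b\<close> lies on the grid of step \<open>1 / q^m\<close>, even for expansions that
  end in digits \<open>q - 1\<close>.\<close>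

definition in_box :: "nat \<Rightarrow> (nat \<Rightarrow> real) \<Rightarrow> 'a \<Rightarrow> bool" where
  "in_box n b \<omega> \<longleftrightarrow> (\<forall>j\<in>{1..d}. \<forall>m. digit_trunc q (\<lambda>i. X j (n - 1 + i) \<omega>) m < b j)"

definition on_grid :: "nat \<Rightarrow> (nat \<Rightarrow> real) \<Rightarrow> bool" where
  "on_grid m b \<longleftrightarrow> (\<forall>j\<in>{1..d}. \<exists>B\<le>q ^ m. b j = real B / real q ^ m)"

lemma measurable_digit: "j \<in> {1..d} \<Longrightarrow> X j i \<in> measurable M (count_space UNIV)"
  using digits_indep unfolding indep_vars_def by force

lemma prob_cylinder:
  assumes a: "\<And>j i. j \<in> {1..d} \<Longrightarrow> i < m \<Longrightarrow> a j i < q"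
  shows "prob {\<omega> \<in> space M. \<forall>j\<in>{1..d}. \<forall>i<m. X j (n + i) \<omega> = a j i} = (1 / real q) ^ (d * m)"
proof (cases "{1..d} \<times> {n..<n+m} = {}")
  case True
  then have "d = 0 \<or> m = 0"
    by auto
  then show ?thesis
    by (auto simp: prob_space)
next
  case False
  let ?J = "{1..d} \<times> {n..<n+m}"
  have "prob (\<Inter>p\<in>?J. X (fst p) (snd p) -` {a (fst p) (snd p - n)} \<inter> space M)
      = (\<Prod>p\<in>?J. prob (X (fst p) (snd p) -` {a (fst p) (snd p - n)} \<inter> space M))"
    using False by (intro indep_varsD[OF digits_indep]) auto
  also have "\<dots> = (\<Prod>p\<in>?J. 1 / real q)"
  proof (rule prod.cong[OF refl])
    fix p assume "p \<in> ?J"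
    then have "prob {\<omega> \<in> space M. X (fst p) (snd p) \<omega> = a (fst p) (snd p - n)} = 1 / real q"
      by (intro digit_uniform a) auto
    then show "prob (X (fst p) (snd p) -` {a (fst p) (snd p - n)} \<inter> space M) = 1 / real q"
      by (simp add: vimage_def Int_def conj_commute)
  qed
  also have "\<dots> = (1 / real q) ^ (d * m)"
    by (simp add: card_cartesian_product)
  also have "(\<Inter>p\<in>?J. X (fst p) (snd p) -` {a (fst p) (snd p - n)} \<inter> space M)
      = {\<omega> \<in> space M. \<forall>j\<in>{1..d}. \<forall>i<m. X j (n + i) \<omega> = a j i}" (is "?L = ?R")
  proof (intro Set.set_eqI iffI)
    fix \<omega> assume \<omega>: "\<omega> \<in> ?L"
    then have "X j (n + i) \<omega> = a j i" if "j \<in> {1..d}" "i < m" for j i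
      using INT_D[OF \<omega>, of "(j, n + i)"] that by simp
    moreover have "\<omega> \<in> space M"
      using \<omega> False by blast
    ultimately show "\<omega> \<in> ?R"
      by simp
  next
    fix \<omega> assume \<omega>: "\<omega> \<in> ?R"
    have "X (fst p) (snd p) \<omega> = a (fst p) (snd p - n)" if "p \<in> ?J" for p
      using \<omega> that by (auto dest!: bspec[of _ _ "fst p"] spec[of _ "snd p - n"])
    then show "\<omega> \<in> ?L"
      using \<omega> by simp
  qed
  finally show ?thesis .
qed

lemma in_box_grid_iff:
  assumes "\<And>j. j \<in> {1..d} \<Longrightarrow> b j = real (B j) / real q ^ m"
  shows "in_box n b \<omega> \<longleftrightarrow> (\<forall>j\<in>{1..d}. digit_nat q (\<lambda>i. X j (n - 1 + i) \<omega>) m < B j)"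
  unfolding in_box_def using assms digit_less by (simp add: digit_trunc_less_grid_iff)

text \<open>The first \<open>m\<close> digits of the \<open>d\<close> coordinates are uniform on
  \<open>q^(d * m)\<close> values, and the product of the \<open>B j\<close> counts those in the
  box. Since the probability is exactly the volume, the means need no correction term.\<close>

lemma in_box_event:
  assumes "on_grid m b"
  shows "{\<omega> \<in> space M. in_box n b \<omega>} \<in> events"
    and prob_in_box: "prob {\<omega> \<in> space M. in_box n b \<omega>} = (\<Prod>j=1..d. b j)"
proof -
  obtain B where B: "\<And>j. j \<in> {1..d} \<Longrightarrow> B j \<le> q ^ m" "\<And>j. j \<in> {1..d} \<Longrightarrow> b j = real (B j) / real q ^ m"
    using assms unfolding on_grid_def by metis
  let ?V = "\<Pi>\<^sub>E j\<in>{1..d}. {..<B j}"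
  define E where "E v = {\<omega> \<in> space M. \<forall>j\<in>{1..d}. digit_nat q (\<lambda>i. X j (n - 1 + i) \<omega>) m = v j}" for v
  have E: "E v \<in> events" "prob (E v) = (1 / real q) ^ (d * m)" if v: "v \<in> ?V" for v
  proof -
    have v_less: "v j < q ^ m" if "j \<in> {1..d}" for j
      using less_le_trans[OF _ B(1)[OF that]] v that by (simp add: PiE_iff)
    have E_eq: "E v = {\<omega> \<in> space M. \<forall>j\<in>{1..d}. \<forall>i<m. X j (n - 1 + i) \<omega> = v j div q ^ (m - Suc i) mod q}"
      using v_less digit_less unfolding E_def by (intro Collect_cong conj_cong refl ball_cong digit_nat_eq_iff)
    note [measurable] = measurable_digit
    show "E v \<in> events"
      unfolding E_eq by measurable
    show "prob (E v) = (1 / real q) ^ (d * m)"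
      unfolding E_eq using q_ge_2 by (intro prob_cylinder) auto
  qed
  have iff: "in_box n b \<omega> \<longleftrightarrow> (\<forall>j\<in>{1..d}. digit_nat q (\<lambda>i. X j (n - 1 + i) \<omega>) m < B j)" for \<omega>
    by (rule in_box_grid_iff) (rule B(2))
  have fin: "finite ?V"
    by (intro finite_PiE) auto
  have eq: "{\<omega> \<in> space M. in_box n b \<omega>} = (\<Union>v\<in>?V. E v)"
  proof (intro Set.set_eqI iffI)
    fix \<omega> assume \<omega>: "\<omega> \<in> {\<omega> \<in> space M. in_box n b \<omega>}"
    let ?v = "\<lambda>j\<in>{1..d}. digit_nat q (\<lambda>i. X j (n - 1 + i) \<omega>) m"
    have "?v \<in> ?V" "\<omega> \<in> E ?v"
      using \<omega> by (auto simp: iff E_def)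
    then show "\<omega> \<in> (\<Union>v\<in>?V. E v)"
      by blast
  qed (auto simp: iff E_def PiE_iff)
  show "{\<omega> \<in> space M. in_box n b \<omega>} \<in> events"
    unfolding eq using E(1) fin by (intro sets.finite_UN) auto
  have "disjoint_family_on E ?V"
    unfolding disjoint_family_on_def
  proof (intro ballI impI)
    fix v w assume vw: "v \<in> ?V" "w \<in> ?V" "v \<noteq> w"
    then obtain j where "j \<in> {1..d}" "v j \<noteq> w j"
      by (meson PiE_ext)
    then show "E v \<inter> E w = {}"
      by (auto simp: E_def)
  qed
  then have "prob {\<omega> \<in> space M. in_box n b \<omega>} = (\<Sum>v\<in>?V. prob (E v))"
    unfolding eq using E(1) fin by (intro finite_measure_finite_Union) auto
  also have "\<dots> = real (card ?V) * (1 / real q) ^ (d * m)"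
    using E(2) by simp
  also have "\<dots> = (\<Prod>j=1..d. b j)"
    using q_ge_2 B(2) by (simp add: card_PiE prod_dividef power_mult[symmetric] power_one_over mult.commute)
  finally show "prob {\<omega> \<in> space M. in_box n b \<omega>} = (\<Prod>j=1..d. b j)" .
qed

text \<open>A box of digit length \<open>m\<close> sees only the window
  \<open>{n - 1..<n - 1 + m}\<close> of digits, and windows whose starts differ by a nonzero
  multiple of \<open>m\<close> are disjoint. Both boxes lie on the same grid, so one window serves
  their difference.\<close>

lemma indep_vars_in_box:
  assumes b: "on_grid m b" "on_grid m b'" and m: "m > 0"
  shows "indep_vars (\<lambda>_. borel) (\<lambda>n \<omega>. of_bool (in_box n b \<omega>) - of_bool (in_box n b' \<omega>) :: real)
    {n \<in> {1..N}. n mod m = r}"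
proof -
  obtain B where B: "\<And>j. j \<in> {1..d} \<Longrightarrow> b j = real (B j) / real q ^ m"
    using b(1) unfolding on_grid_def by metis
  obtain B' where B': "\<And>j. j \<in> {1..d} \<Longrightarrow> b' j = real (B' j) / real q ^ m"
    using b(2) unfolding on_grid_def by metis
  let ?I = "{n \<in> {1..N}. n mod m = r}"
  define K where "K n = {1..d} \<times> {n - 1..<n - 1 + m}" for n
  define g where "g n w = (of_bool (\<forall>j\<in>{1..d}. digit_nat q (\<lambda>i. w (j, n - 1 + i)) m < B j)
     - of_bool (\<forall>j\<in>{1..d}. digit_nat q (\<lambda>i. w (j, n - 1 + i)) m < B' j) :: real)" for n w
  have disj: "disjoint_family_on K ?I"
    unfolding disjoint_family_on_def
  proof (intro ballI impI, rule ccontr)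
    fix n n' assume n: "n \<in> ?I" "n' \<in> ?I" "n \<noteq> n'" and "K n \<inter> K n' \<noteq> {}"
    then have "n < n' + m" "n' < n + m"
      by (auto simp: K_def)
    then have "\<bar>int n - int n'\<bar> < int m"
      by linarith
    moreover have "int m dvd int n - int n'"
      using n by (metis (lifting) mem_Collect_eq mod_eq_dvd_iff zmod_int)
    ultimately show False
      using n(3) by (metis dvd_imp_le_int abs_of_nat eq_iff_diff_eq_0 linorder_not_less of_nat_eq_iff)
  qed
  have "indep_vars (\<lambda>n. PiM (K n) (\<lambda>_. count_space UNIV))
      (\<lambda>n \<omega>. restrict (\<lambda>p. X (fst p) (snd p) \<omega>) (K n)) ?I"
    by (rule indep_vars_restrict[OF digits_indep _ disj]) (auto simp: K_def)
  then have "indep_vars (\<lambda>_. borel) (\<lambda>n \<omega>. g n (restrict (\<lambda>p. X (fst p) (snd p) \<omega>) (K n))) ?I"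
  proof (rule indep_vars_compose2)
    fix n
    \<comment> \<open>A finite product of countable discrete spaces is discrete, so every function
      on it is measurable.\<close>
    show "g n \<in> borel_measurable (PiM (K n) (\<lambda>_. count_space (UNIV :: nat set)))"
      by (subst count_space_PiM_finite) (auto simp: K_def)
  qed
  moreover have "g n (restrict (\<lambda>p. X (fst p) (snd p) \<omega>) (K n))
      = of_bool (in_box n b \<omega>) - of_bool (in_box n b' \<omega>)" for n \<omega>
  proof -
    have "digit_nat q (\<lambda>i. restrict (\<lambda>p. X (fst p) (snd p) \<omega>) (K n) (j, n - 1 + i)) m
        = digit_nat q (\<lambda>i. X j (n - 1 + i) \<omega>) m" if "j \<in> {1..d}" for j
      using that by (intro digit_nat_cong) (simp add: K_def)
    then have "g n (restrict (\<lambda>p. X (fst p) (snd p) \<omega>) (K n))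
        = of_bool (\<forall>j\<in>{1..d}. digit_nat q (\<lambda>i. X j (n - 1 + i) \<omega>) m < B j)
        - of_bool (\<forall>j\<in>{1..d}. digit_nat q (\<lambda>i. X j (n - 1 + i) \<omega>) m < B' j)"
      unfolding g_def by (simp only: cong: ball_cong)
    moreover have "in_box n b \<omega> \<longleftrightarrow> (\<forall>j\<in>{1..d}. digit_nat q (\<lambda>i. X j (n - 1 + i) \<omega>) m < B j)"
      by (rule in_box_grid_iff) (rule B)
    moreover have "in_box n b' \<omega> \<longleftrightarrow> (\<forall>j\<in>{1..d}. digit_nat q (\<lambda>i. X j (n - 1 + i) \<omega>) m < B' j)"
      by (rule in_box_grid_iff) (rule B')
    ultimately show ?thesis
      by (simp only:)
  qed
  ultimately show ?thesis
    by simp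
qed

lemma in_box_min: "in_box n b \<omega> \<and> in_box n b' \<omega> \<longleftrightarrow> in_box n (\<lambda>j. min (b j) (b' j)) \<omega>"
  unfolding in_box_def by auto

lemma on_grid_min: "on_grid m b \<Longrightarrow> on_grid m b' \<Longrightarrow> on_grid m (\<lambda>j. min (b j) (b' j))"
  unfolding on_grid_def min_def by auto

text \<open>The squared difference of two indicators is the indicator of the symmetric difference.
  Anchored boxes intersect in the box anchored at the minimum of the corners, so the second moment
  is the expression bounded by \<open>s\<close>, also for boxes that are not nested.\<close>

lemma box_pair_tail_bound:
  assumes b: "on_grid m b" "on_grid m b'" and m: "m > 0"
    and s: "(\<Prod>j=1..d. b j) + (\<Prod>j=1..d. b' j) - 2 * (\<Prod>j=1..d. min (b j) (b' j)) \<le> s" "s \<le> 2"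
    and l: "l * real m \<le> 1" "0 < l"
  shows "prob {\<omega> \<in> space M.
      \<bar>(\<Sum>n=1..N. of_bool (in_box n b \<omega>) - of_bool (in_box n b' \<omega>))
        - real N * ((\<Prod>j=1..d. b j) - (\<Prod>j=1..d. b' j))\<bar> \<ge> T}
    \<le> 2 * exp (2 + real N * real m * l\<^sup>2 * s - l * T)"
proof (rule block_sum_tail_bound)
  let ?Y = "\<lambda>n \<omega>. of_bool (in_box n b \<omega>) - of_bool (in_box n b' \<omega>) :: real"
  let ?c = "\<lambda>j. min (b j) (b' j)"
  have int: "integrable M (\<lambda>\<omega>. of_bool (in_box n a \<omega>) :: real)"
    and ex: "expectation (\<lambda>\<omega>. of_bool (in_box n a \<omega>)) = (\<Prod>j=1..d. a j)" if a: "on_grid m a" for n a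
  proof -
    let ?E = "{\<omega> \<in> space M. in_box n a \<omega>}"
    have "integrable M (\<lambda>\<omega>. of_bool (in_box n a \<omega>) :: real) \<longleftrightarrow> integrable M (indicator ?E :: _ \<Rightarrow> real)"
      by (intro Bochner_Integration.integrable_cong) (auto simp: indicator_def)
    then show "integrable M (\<lambda>\<omega>. of_bool (in_box n a \<omega>) :: real)"
      using in_box_event(1)[OF a, of n] by (simp add: integrable_indicator_iff emeasure_eq_measure)
    have "expectation (\<lambda>\<omega>. of_bool (in_box n a \<omega>)) = expectation (indicator ?E)"
      by (intro Bochner_Integration.integral_cong) (auto simp: indicator_def)
    also have "\<dots> = prob ?E"
      by (simp add: Int_absorb2)
    finally show "expectation (\<lambda>\<omega>. of_bool (in_box n a \<omega>)) = (\<Prod>j=1..d. a j)"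
      using in_box_event(2)[OF a, of n] by (simp only:)
  qed
  note c = on_grid_min[OF b]
  show "?Y n \<in> borel_measurable M" for n
    using int[OF b(1), of n] int[OF b(2), of n] by simp
  show "\<bar>?Y n \<omega>\<bar> \<le> 1" for n \<omega>
    by simp
  show "expectation (?Y n) = (\<Prod>j=1..d. b j) - (\<Prod>j=1..d. b' j)" for n
    using int b ex by simp
  have sq: "(?Y n \<omega>)\<^sup>2 = of_bool (in_box n b \<omega>) + of_bool (in_box n b' \<omega>) - 2 * of_bool (in_box n ?c \<omega>)" for n \<omega>
    unfolding in_box_min[symmetric] by (auto simp: of_bool_def)
  have var: "expectation (\<lambda>\<omega>. (?Y n \<omega>)\<^sup>2)
      = (\<Prod>j=1..d. b j) + (\<Prod>j=1..d. b' j) - 2 * (\<Prod>j=1..d. min (b j) (b' j))" for n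
    unfolding sq using int[OF b(1)] int[OF b(2)] int[OF c] ex[OF b(1)] ex[OF b(2)] ex[OF c] by simp
  then show "expectation (\<lambda>\<omega>. (?Y n \<omega>)\<^sup>2) \<le> s" for n
    using s(1) by simp
  \<comment> \<open>Any index would do here; taking 0 makes the conclusion independent of
    \<open>N\<close>.\<close>
  have "0 \<le> expectation (\<lambda>\<omega>. (?Y 0 \<omega>)\<^sup>2)"
    by simp
  then show "0 \<le> s"
    using var[of 0] s(1) by linarith
  show "indep_vars (\<lambda>_. borel) ?Y {n \<in> {1..N}. n mod m = r}" for r
    using indep_vars_in_box[OF b m] .
qed (use m s l in auto)

end

section \<open>Bracketing covers of anchored boxes\<close>

lemma one_div_one_minus_exp_le:
  fixes \<beta> :: real
  assumes "\<beta> > 0"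
  shows "1 / (1 - exp (- \<beta>)) \<le> 1 + 1 / \<beta>"
proof -
  have "exp (- \<beta>) \<le> 1 / (1 + \<beta>)"
    using exp_ge_add_one_self[of \<beta>] assms by (simp add: exp_minus field_simps)
  then have "\<beta> / (1 + \<beta>) \<le> 1 - exp (- \<beta>)"
    using assms by (simp add: field_simps)
  then have "1 / (1 - exp (- \<beta>)) \<le> 1 / (\<beta> / (1 + \<beta>))"
    using assms by (intro divide_left_mono mult_pos_pos) auto
  then show ?thesis
    using assms by (simp add: add_divide_distrib)
qed

text \<open>Each vector with \<open>\<Sum> n \<le> d T\<close> has weight at least \<open>exp (- d)\<close> under the product
  of geometric weights \<open>exp (- n / T)\<close>.\<close>

lemma card_bounded_sum_le:
  fixes T :: real
  assumes T: "T > 0" and R: "real R \<le> real d * T"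
  shows "real (card {n \<in> {1..d} \<rightarrow>\<^sub>E {..Q::nat}. (\<Sum>j=1..d. n j) \<le> R}) \<le> (exp 1 * (1 + T)) ^ d"
proof -
  let ?V = "{1..d} \<rightarrow>\<^sub>E {..Q}"
  let ?A = "{n \<in> ?V. (\<Sum>j=1..d. n j) \<le> R}"
  define x where "x = exp (- 1 / T)"
  have x: "0 < x" "x < 1"
    using T by (auto simp: x_def)
  have fin: "finite ?V"
    by (intro finite_PiE) auto
  have "real (card ?A) = (\<Sum>n\<in>?A. 1)"
    by simp
  also have "\<dots> \<le> (\<Sum>n\<in>?A. exp (real d) * (\<Prod>j=1..d. x ^ n j))"
  proof (rule sum_mono)
    fix n assume "n \<in> ?A"
    then have "(\<Sum>j=1..d. n j) \<le> R"
      by simp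
    then have "real (\<Sum>j=1..d. n j) \<le> real R"
      by (simp only: of_nat_le_iff)
    then have "real (\<Sum>j=1..d. n j) / T \<le> real d"
      using R T by (simp add: pos_divide_le_eq del: of_nat_sum)
    moreover have "(\<Prod>j=1..d. x ^ n j) = x ^ (\<Sum>j=1..d. n j)"
      by (rule power_sum[symmetric])
    moreover have "x ^ m = exp (- (real m / T))" for m
      by (simp add: x_def exp_of_nat_mult[symmetric])
    ultimately show "1 \<le> exp (real d) * (\<Prod>j=1..d. x ^ n j)"
      by (simp add: exp_add[symmetric] del: of_nat_sum)
  qed
  also have "\<dots> \<le> (\<Sum>n\<in>?V. exp (real d) * (\<Prod>j=1..d. x ^ n j))"
    using fin x by (intro sum_mono2) (auto intro!: mult_nonneg_nonneg prod_nonneg)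
  also have "\<dots> = exp (real d) * (\<Prod>j=1..d. \<Sum>i\<le>Q. x ^ i)"
    by (subst prod_sum_PiE) (auto simp: sum_distrib_left)
  also have "\<dots> = (exp 1 * (\<Sum>i\<le>Q. x ^ i)) ^ d"
    by (simp add: power_mult_distrib exp_of_nat_mult[symmetric])
  also have "\<dots> \<le> (exp 1 * (1 + T)) ^ d"
  proof (intro power_mono mult_left_mono mult_nonneg_nonneg)
    have "(\<Sum>i\<le>Q. x ^ i) \<le> (\<Sum>i. x ^ i)"
      using x by (intro sum_le_suminf summable_geometric) auto
    also have "\<dots> = 1 / (1 - exp (- (1 / T)))"
      using x suminf_geometric[of x] by (simp add: x_def)
    also have "\<dots> \<le> 1 + 1 / (1 / T)"
      using T by (intro one_div_one_minus_exp_le) auto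
    finally show "(\<Sum>i\<le>Q. x ^ i) \<le> 1 + T"
      by simp
  qed (use x in \<open>auto intro!: sum_nonneg\<close>)
  finally show ?thesis .
qed

text \<open>Serves \<open>cover_bracket\<close>, where a vector whose total is too large is lowered
  to one with exactly the permitted total.\<close>

lemma exists_smaller_with_sum:
  fixes n :: "'b \<Rightarrow> nat"
  assumes "finite A" "R \<le> sum n A"
  shows "\<exists>g. (\<forall>j\<in>A. g j \<le> n j) \<and> sum g A = R"
  using assms
proof (induction A arbitrary: R rule: finite_induct)
  case (insert a A)
  show ?case
  proof (cases "R \<le> sum n A")
    case True
    then obtain g where "\<forall>j\<in>A. g j \<le> n j" "sum g A = R"
      using insert.IH by blast
    moreover have "sum (g(a := 0)) A = sum g A"
      using insert.hyps by (intro sum.cong) auto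
    ultimately show ?thesis
      using insert.hyps by (intro exI[of _ "g(a := 0)"]) simp
  next
    case False
    moreover have "sum (n(a := R - sum n A)) A = sum n A"
      using insert.hyps by (intro sum.cong) auto
    ultimately show ?thesis
      using insert.hyps insert.prems by (intro exI[of _ "n(a := R - sum n A)"]) auto
  qed
qed simp

lemma prod_diff_le_card_mult:
  fixes a b :: "'b \<Rightarrow> real"
  assumes "\<And>j. j \<in> A \<Longrightarrow> 0 \<le> a j \<and> a j \<le> b j \<and> b j \<le> 1 \<and> b j - a j \<le> e"
  shows "(\<Prod>j\<in>A. b j) - (\<Prod>j\<in>A. a j) \<le> real (card A) * e"
proof -
  have "norm ((\<Prod>j\<in>A. b j) - (\<Prod>j\<in>A. a j)) \<le> (\<Sum>j\<in>A. norm (b j - a j))"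
    using assms by (intro norm_prod_diff) (force simp: abs_le_iff)+
  also have "\<dots> \<le> (\<Sum>j\<in>A. e)"
    using assms by (intro sum_mono) (simp add: abs_of_nonneg)
  finally show ?thesis
    by simp
qed

text \<open>The least digit length whose grid step is at most \<open>4^(-k) / d\<close>: moving all
  \<open>d\<close> coordinates of a corner by one step then changes the volume by at most
  \<open>4^(-k)\<close>.\<close>

definition cover_exp :: "nat \<Rightarrow> nat \<Rightarrow> nat \<Rightarrow> nat" where
  "cover_exp q d k = (LEAST m. d * 4 ^ k \<le> q ^ m)"

text \<open>Corners are encoded by their defects, counted in grid steps below 1, because the total
  defect controls the volume through \<open>1 - y \<le> exp (- y)\<close>.\<close>

definition cover_box :: "nat \<Rightarrow> nat \<Rightarrow> nat \<Rightarrow> (nat \<Rightarrow> nat) \<Rightarrow> nat \<Rightarrow> real" where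
  "cover_box q d k n = (\<lambda>j\<in>{1..d}. 1 - real (n j) / real q ^ cover_exp q d k)"

text \<open>Boxes whose corner has \<open>\<Sum>j (1 - b j)\<close> much larger than \<open>2 k\<close> have volume at most
  \<open>4^(-k)\<close> and are left out: the whole grid would have about \<open>(d 4^k)^d\<close> points and cost an extra
  factor \<open>sqrt (ln d)\<close>.\<close>

definition cover :: "nat \<Rightarrow> nat \<Rightarrow> nat \<Rightarrow> (nat \<Rightarrow> real) set" where
  "cover q d k = cover_box q d k `
     {n \<in> {1..d} \<rightarrow>\<^sub>E {..q ^ cover_exp q d k}. (\<Sum>j=1..d. n j) \<le> q ^ cover_exp q d k * (2 * k) + d}"

section \<open>Digit length, cardinality and bracketing property of the covers\<close>

context
  fixes q d :: nat
  assumes q: "q \<ge> 2" and d: "d \<ge> 2"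
begin

lemma cover_exp_ge: "d * 4 ^ k \<le> q ^ cover_exp q d k"
  unfolding cover_exp_def
proof (rule LeastI_ex)
  have "d * 4 ^ k < 2 ^ (d * 4 ^ k)"
    by (rule less_exp)
  also have "\<dots> \<le> q ^ (d * 4 ^ k)"
    using q by (intro power_mono) auto
  finally show "\<exists>m. d * 4 ^ k \<le> q ^ m"
    using less_imp_le by blast
qed

lemma cover_exp_pos: "cover_exp q d k > 0"
proof (rule ccontr)
  assume "\<not> cover_exp q d k > 0"
  then have "d * 4 ^ k \<le> 1"
    using cover_exp_ge[of k] by simp
  moreover have "d * 1 \<le> d * 4 ^ k"
    by (intro mult_le_mono2) simp
  ultimately show False
    using d by linarith
qed

lemma cover_exp_pred_less: "q ^ (cover_exp q d k - 1) < d * 4 ^ k"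
proof (rule ccontr)
  assume "\<not> q ^ (cover_exp q d k - 1) < d * 4 ^ k"
  then have "cover_exp q d k \<le> cover_exp q d k - 1"
    unfolding cover_exp_def[of q d k] by (intro Least_le) simp
  then show False
    using cover_exp_pos[of k] by linarith
qed

lemma cover_exp_le: "q ^ cover_exp q d k \<le> q * (d * 4 ^ k)"
proof -
  have "q ^ cover_exp q d k = q * q ^ (cover_exp q d k - 1)"
    using cover_exp_pos[of k] by (metis Suc_diff_1 power_Suc)
  then show ?thesis
    using cover_exp_pred_less[of k] by simp
qed

lemma cover_exp_mono: "k \<le> k' \<Longrightarrow> cover_exp q d k \<le> cover_exp q d k'"
proof -
  assume "k \<le> k'"
  then have "d * 4 ^ k \<le> d * 4 ^ k'"
    by (intro mult_le_mono2 power_increasing) auto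
  then show "cover_exp q d k \<le> cover_exp q d k'"
    using order_trans[OF _ cover_exp_ge[of k']] unfolding cover_exp_def[of q d k] by (intro Least_le)
qed

text \<open>Minimality gives \<open>q^(m - 1) < d * 4^k\<close>, where \<open>q\<close> may be
  lowered to 2. As \<open>d \<ge> 2\<close>, \<open>ln d\<close> absorbs the multiples of
  \<open>ln 2\<close>, and \<open>ln 2 \<ge> 2 / 3\<close> turns the factor 4 into 6.\<close>

lemma cover_exp_le_ln:
  assumes k: "k \<ge> 1"
  shows "real (cover_exp q d k) \<le> 6 * real k * ln (real d)"
proof -
  let ?m = "cover_exp q d k"
  have ln2: "ln (2 :: real) \<ge> 2 / 3"
    by (rule ln2_ge_two_thirds)
  have ln_d: "ln (real d) \<ge> ln 2"
    using d by simp
  have "(2 :: nat) ^ (?m - 1) \<le> q ^ (?m - 1)"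
    using q by (intro power_mono) auto
  then have "2 ^ (?m - 1) \<le> d * 4 ^ k"
    using cover_exp_pred_less[of k] by linarith
  then have "real (2 ^ (?m - 1)) \<le> real (d * 4 ^ k)"
    by (simp only: of_nat_le_iff)
  then have "ln (2 ^ (?m - 1)) \<le> ln (real d * 4 ^ k)"
    using d by (subst ln_le_cancel_iff) auto
  moreover have "ln (4 :: real) = 2 * ln 2"
    using ln_realpow[of "2 :: real" 2] by simp
  ultimately have "real (?m - 1) * ln 2 \<le> ln (real d) + 2 * real k * ln 2"
    using d by (simp add: ln_mult ln_realpow)
  then have "real ?m * ln 2 \<le> ln (real d) + (2 * real k + 1) * ln 2"
    using cover_exp_pos[of k] by (simp add: of_nat_diff algebra_simps)
  also have "\<dots> \<le> ln (real d) + (2 * real k + 1) * ln (real d)"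
    using ln_d by (intro add_left_mono mult_left_mono) auto
  also have "\<dots> = (2 * real k + 2) * ln (real d)"
    by (simp add: algebra_simps)
  also have "\<dots> \<le> 4 * real k * ln (real d)"
    using k d by (intro mult_right_mono) auto
  finally have "real ?m * (2 / 3) \<le> 4 * real k * ln (real d)"
    using mult_left_mono[OF ln2, of "real ?m"] by linarith
  then show ?thesis
    by simp
qed

lemma finite_cover: "finite (cover q d k)"
  unfolding cover_def by (intro finite_imageI finite_subset[OF _ finite_PiE[of "{1..d}" "\<lambda>_. {..q ^ cover_exp q d k}"]]) auto

text \<open>The permitted total defect is at most \<open>d * T\<close> with \<open>T\<close> free of
  \<open>d\<close>, since the factor \<open>d\<close> in the grid size disappears when the total is
  averaged over the coordinates. The exponent is therefore linear in \<open>d\<close>, without a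
  logarithm.\<close>

lemma card_cover_le: "real (card (cover q d k)) \<le> exp (real d * real (k + 1) * (3 + ln (real q)))"
proof -
  let ?Q = "q ^ cover_exp q d k"
  define T where "T = real q * 4 ^ k * (2 * real k) + 1"
  have T: "T > 0"
    by (simp add: T_def add_nonneg_pos)
  have "?Q * (2 * k) + d \<le> q * (d * 4 ^ k) * (2 * k) + d"
    using cover_exp_le by (intro add_right_mono mult_le_mono1)
  then have "real (?Q * (2 * k) + d) \<le> real (q * (d * 4 ^ k) * (2 * k) + d)"
    by (simp only: of_nat_le_iff)
  also have "\<dots> = real d * T"
    by (simp add: T_def algebra_simps)
  finally have R: "real (?Q * (2 * k) + d) \<le> real d * T" .
  have "card (cover q d k) \<le> card {n \<in> {1..d} \<rightarrow>\<^sub>E {..?Q}. (\<Sum>j=1..d. n j) \<le> ?Q * (2 * k) + d}"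
    unfolding cover_def by (intro card_image_le finite_subset[OF _ finite_PiE[of "{1..d}" "\<lambda>_. {..?Q}"]]) auto
  then have "real (card (cover q d k)) \<le> (exp 1 * (1 + T)) ^ d"
    using card_bounded_sum_le[OF T R, of ?Q] by linarith
  also have "\<dots> \<le> exp (real (k + 1) * (3 + ln (real q))) ^ d"
  proof (intro power_mono mult_nonneg_nonneg)
    have "1 * 1 \<le> real q * 4 ^ k"
      using q by (intro mult_mono) auto
    then have "1 + T \<le> 2 * (real q * 4 ^ k) * (1 + real k)"
      by (simp add: T_def algebra_simps)
    also have "\<dots> \<le> (exp 1 * (exp (ln (real q)) * exp 2 ^ k)) * exp (real k)"
    proof (intro mult_mono power_mono)
      show "2 \<le> exp (1 :: real)"
        using exp_ge_add_one_self[of 1] by simp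
      show "(4 :: real) \<le> exp 2"
        using \<open>2 \<le> exp (1 :: real)\<close> mult_mono[OF \<open>2 \<le> exp (1 :: real)\<close> \<open>2 \<le> exp (1 :: real)\<close>]
        by (simp add: exp_add[symmetric])
      show "1 + real k \<le> exp (real k)"
        by (rule exp_ge_add_one_self)
    qed (use q in auto)
    also have "\<dots> = exp (1 + ln (real q) + 3 * real k)"
      by (simp add: exp_add[symmetric] exp_of_nat_mult[symmetric])
    finally have "exp 1 * (1 + T) \<le> exp 1 * exp (1 + ln (real q) + 3 * real k)"
      by (intro mult_left_mono) auto
    also have "\<dots> = exp (2 + ln (real q) + 3 * real k)"
      by (simp add: exp_add[symmetric])
    also have "2 + ln (real q) + 3 * real k \<le> real (k + 1) * (3 + ln (real q))"
      using q by (simp add: algebra_simps)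
    finally show "exp 1 * (1 + T) \<le> exp (real (k + 1) * (3 + ln (real q)))"
      by simp
  qed (use T in auto)
  also have "\<dots> = exp (real d * real (k + 1) * (3 + ln (real q)))"
    by (simp add: exp_of_nat_mult[symmetric] mult.assoc)
  finally show ?thesis .
qed

lemma cover_bounds: "b \<in> cover q d k \<Longrightarrow> j \<in> {1..d} \<Longrightarrow> 0 \<le> b j \<and> b j \<le> 1"
  using q by (force simp: cover_def cover_box_def PiE_iff divide_simps)

lemma unit_box_in_cover: "(\<lambda>j\<in>{1..d}. 1) \<in> cover q d k"
proof -
  have "(\<lambda>j\<in>{1..d}. 1) = cover_box q d k (\<lambda>j\<in>{1..d}. 0)"
    by (auto simp: cover_box_def)
  then show ?thesis
    unfolding cover_def by (intro image_eqI) auto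
qed

text \<open>The outer corner rounds \<open>t\<close> up to the grid. If its total defect is within
  \<open>Q * (2 * k)\<close>, lowering every coordinate by one step, but not below 0, gives the
  inner corner. Otherwise a corner above \<open>t\<close> with total defect exactly
  \<open>Q * (2 * k)\<close> already has volume at most \<open>exp (- 2 * k)\<close>, and no inner
  corner is supplied. The inequality \<open>a j < t j\<close> is strict because membership in the
  inner box bounds the point only weakly by \<open>a j\<close>; where \<open>t j = 0\<close>, the
  value \<open>a j = 0\<close> makes the inner box empty.\<close>

lemma cover_bracket:
  assumes t: "\<And>j. j \<in> {1..d} \<Longrightarrow> 0 \<le> t j \<and> t j \<le> 1"
  obtains b where "b \<in> cover q d k" "\<And>j. j \<in> {1..d} \<Longrightarrow> t j \<le> b j"
    "(\<Prod>j=1..d. b j) - (\<Prod>j=1..d. t j) \<le> 1 / 4 ^ k"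
    "(\<Prod>j=1..d. b j) \<le> 1 / 4 ^ k \<or>
      (\<exists>a\<in>cover q d k. (\<forall>j\<in>{1..d}. a j \<le> b j \<and> (a j < t j \<or> a j = 0))
        \<and> (\<Prod>j=1..d. b j) - (\<Prod>j=1..d. a j) \<le> 1 / 4 ^ k)"
proof -
  let ?Q = "q ^ cover_exp q d k"
  define Q where "Q = real q ^ cover_exp q d k"
  have Q_eq: "Q = real ?Q"
    by (simp add: Q_def)
  have "real (d * 4 ^ k) \<le> Q"
    unfolding Q_eq by (simp only: of_nat_le_iff cover_exp_ge)
  then have dQ: "real d / Q \<le> 1 / 4 ^ k" and Q: "Q > 0"
    using q by (auto simp: Q_def field_simps)
  \<comment> \<open>Flooring the defect selects the least grid point that is at least
    \<open>t j\<close>.\<close>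
  define n where "n = (\<lambda>j\<in>{1..d}. nat \<lfloor>Q * (1 - t j)\<rfloor>)"
  have n: "real (n j) \<le> Q * (1 - t j)" "Q * (1 - t j) < real (n j) + 1" "n j \<le> ?Q"
    if j: "j \<in> {1..d}" for j
  proof -
    have nonneg: "0 \<le> Q * (1 - t j)"
      using t[OF j] Q by simp
    then show 1: "real (n j) \<le> Q * (1 - t j)"
      using j by (simp add: n_def)
    show "Q * (1 - t j) < real (n j) + 1"
      using j nonneg by (simp add: n_def)
    have "Q * (1 - t j) \<le> Q"
      using t[OF j] Q by simp
    with 1 have "real (n j) \<le> real ?Q"
      by (simp only: Q_eq)
    then show "n j \<le> ?Q"
      by (simp only: of_nat_le_iff)
  qed
  have t_le: "t j \<le> 1 - real (g j) / Q" if "g j \<le> n j" "j \<in> {1..d}" for g j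
  proof -
    have "real (g j) \<le> Q * (1 - t j)"
      using n(1)[OF that(2)] that(1) by linarith
    then show ?thesis
      using Q by (simp add: field_simps)
  qed
  have box: "cover_box q d k g j = 1 - real (g j) / Q" if "j \<in> {1..d}" for g j
    using that by (simp add: cover_box_def Q_def)
  show ?thesis
  proof (cases "(\<Sum>j=1..d. n j) \<le> ?Q * (2 * k)")
    case True
    define n' where "n' = (\<lambda>j\<in>{1..d}. min (n j + 1) ?Q)"
    let ?b = "cover_box q d k n" and ?a = "cover_box q d k n'"
    \<comment> \<open>Raising each defect by one costs at most \<open>d\<close> in total; this is
      the slack \<open>+ d\<close> in \<open>cover\<close>.\<close>
    have "(\<Sum>j=1..d. n' j) \<le> (\<Sum>j=1..d. n j + 1)"
      by (intro sum_mono) (simp add: n'_def)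
    also have "\<dots> \<le> ?Q * (2 * k) + d"
      using True by (simp only: sum.distrib) simp
    finally have a: "?a \<in> cover q d k"
      unfolding cover_def by (intro imageI) (auto simp: n'_def)
    have b: "?b \<in> cover q d k"
      unfolding cover_def using True n(3) by (intro imageI) (auto simp: n_def PiE_iff extensional_def)
    have ab: "?a j \<le> ?b j" "?b j - ?a j \<le> 1 / Q" "?a j < t j \<or> ?a j = 0" if j: "j \<in> {1..d}" for j
    proof -
      have "n j \<le> n' j" "n' j \<le> n j + 1"
        using n(3)[OF j] j by (auto simp: n'_def)
      then have "real (n j) \<le> real (n' j)" "real (n' j) \<le> real (n j) + 1"
        by linarith+
      then show "?a j \<le> ?b j" "?b j - ?a j \<le> 1 / Q"
        using Q j by (auto simp: box divide_right_mono diff_divide_distrib[symmetric] add_divide_distrib[symmetric])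
      show "?a j < t j \<or> ?a j = 0"
      proof (cases "n j < ?Q")
        case True
        then have "n' j = n j + 1"
          using j by (simp add: n'_def)
        then have "Q * (1 - t j) < real (n' j)"
          using n(2)[OF j] by simp
        then show ?thesis
          using Q j by (simp add: box field_simps)
      next
        case False
        then have "n' j = ?Q"
          using j by (simp add: n'_def)
        then have "real (n' j) = Q"
          by (simp only: Q_eq)
        then show ?thesis
          using Q j by (simp add: box)
      qed
    qed
    have tb: "t j \<le> ?b j" if "j \<in> {1..d}" for j
      using t_le[of n j] that by (simp add: box)
    have bt: "?b j - t j \<le> 1 / Q" if j: "j \<in> {1..d}" for j
    proof -
      have "(Q * (1 - t j) - real (n j)) / Q \<le> 1 / Q"
        using n(2)[OF j] Q by (intro divide_right_mono) auto
      moreover have "?b j - t j = (Q * (1 - t j) - real (n j)) / Q"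
        using Q j by (simp add: box diff_divide_distrib)
      ultimately show ?thesis
        by simp
    qed
    have "(\<Prod>j=1..d. ?b j) - (\<Prod>j=1..d. t j) \<le> real (card {1..d}) * (1 / Q)"
      using t tb bt cover_bounds[OF b] by (intro prod_diff_le_card_mult) auto
    moreover have "(\<Prod>j=1..d. ?b j) - (\<Prod>j=1..d. ?a j) \<le> real (card {1..d}) * (1 / Q)"
      using ab cover_bounds[OF b] cover_bounds[OF a] by (intro prod_diff_le_card_mult) auto
    moreover have "\<forall>j\<in>{1..d}. ?a j \<le> ?b j \<and> (?a j < t j \<or> ?a j = 0)"
      using ab by blast
    ultimately show ?thesis
      using dQ a b tb by (intro that[of ?b] disjI2 bexI[of _ ?a] conjI) auto
  next
    case False
    then obtain g where g: "\<forall>j\<in>{1..d}. g j \<le> n j" "sum g {1..d} = ?Q * (2 * k)"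
      using exists_smaller_with_sum[of "{1..d}" "?Q * (2 * k)" n] by auto
    define h where "h = restrict g {1..d}"
    let ?b = "cover_box q d k h"
    have h: "h j \<le> n j" if "j \<in> {1..d}" for j
      using g(1) that by (simp add: h_def)
    have sum_h: "sum h {1..d} = ?Q * (2 * k)"
      using g(2) by (simp add: h_def)
    have b: "?b \<in> cover q d k"
      unfolding cover_def using sum_h order_trans[OF h n(3)] by (intro imageI) (auto simp: h_def)
    have tb: "t j \<le> ?b j" if "j \<in> {1..d}" for j
      using t_le[of h j, OF h[OF that] that] that by (simp add: box)
    have "(\<Prod>j=1..d. ?b j) \<le> (\<Prod>j=1..d. exp (- (real (h j) / Q)))"
    proof (intro prod_mono conjI)
      fix j assume j: "j \<in> {1..d}"
      show "0 \<le> ?b j"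
        using cover_bounds[OF b j] by simp
      show "?b j \<le> exp (- (real (h j) / Q))"
        using exp_ge_add_one_self[of "- (real (h j) / Q)"] j by (simp add: box)
    qed
    also have "\<dots> = exp (- (real (sum h {1..d}) / Q))"
      by (simp add: exp_sum[symmetric] sum_negf sum_divide_distrib)
    also have "real (sum h {1..d}) / Q = 2 * real k"
      using Q by (simp only: sum_h of_nat_mult Q_eq[symmetric]) simp
    also have "exp (- (2 * real k)) = 1 / exp 2 ^ k"
      by (simp add: exp_minus exp_of_nat_mult[symmetric] field_simps)
    \<comment> \<open>The origin of the factor 2 in the cap \<open>2 * k\<close> of
      \<open>cover\<close>: \<open>exp 2 \<ge> 4\<close>.\<close>
    also have "\<dots> \<le> 1 / 4 ^ k"
    proof -
      have "2 \<le> exp (1 :: real)"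
        using exp_ge_add_one_self[of 1] by simp
      then have "(4 :: real) \<le> exp 2"
        using mult_mono[OF \<open>2 \<le> exp (1 :: real)\<close> \<open>2 \<le> exp (1 :: real)\<close>] by (simp add: exp_add[symmetric])
      then show ?thesis
        by (intro divide_left_mono power_mono) auto
    qed
    finally have "(\<Prod>j=1..d. ?b j) \<le> 1 / 4 ^ k" .
    moreover have "0 \<le> (\<Prod>j=1..d. t j)"
      using t by (intro prod_nonneg) auto
    ultimately show ?thesis
      using b tb by (intro that[of ?b]) auto
  qed
qed

end

section \<open>Chaining\<close>

context uniform_digits
begin

text \<open>The \<open>q\<close>-adic grids are nested, so corners of levels \<open>k - 1\<close>
  and \<open>k\<close> can both be treated with the digit length of level \<open>k\<close>.\<close>

lemma on_grid_cover:
  assumes d: "d \<ge> 2" and b: "b \<in> cover q d k" and k: "k \<le> k'"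
  shows "on_grid (cover_exp q d k') b"
  unfolding on_grid_def
proof
  fix j assume j: "j \<in> {1..d}"
  let ?m = "cover_exp q d k" and ?m' = "cover_exp q d k'"
  obtain n where "n \<in> {1..d} \<rightarrow>\<^sub>E {..q ^ ?m}" and b_eq: "b = cover_box q d k n"
    using b by (auto simp: cover_def)
  then have n: "n j \<le> q ^ ?m" "b = cover_box q d k n"
    using PiE_mem[OF _ j] by auto
  have "?m \<le> ?m'"
    by (rule cover_exp_mono[OF q_ge_2 d k])
  then have split: "q ^ ?m' = q ^ ?m * q ^ (?m' - ?m)"
    by (simp add: power_add[symmetric])
  have "b j = real (q ^ ?m - n j) / real q ^ ?m"
    using n j q_ge_2 by (simp add: cover_box_def of_nat_diff diff_divide_distrib)
  also have "\<dots> = real ((q ^ ?m - n j) * q ^ (?m' - ?m)) / real (q ^ ?m * q ^ (?m' - ?m))"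
    using q_ge_2 by simp
  also have "\<dots> = real ((q ^ ?m - n j) * q ^ (?m' - ?m)) / real q ^ ?m'"
    by (simp only: split[symmetric] of_nat_power)
  finally show "\<exists>B\<le>q ^ ?m'. b j = real B / real q ^ ?m'"
    unfolding split by (intro exI[of _ "(q ^ ?m - n j) * q ^ (?m' - ?m)"]) auto
qed

definition box_count :: "nat \<Rightarrow> (nat \<Rightarrow> real) \<Rightarrow> 'a \<Rightarrow> real" where
  "box_count N b \<omega> = (\<Sum>n=1..N. of_bool (in_box n b \<omega>))"

text \<open>The last condition bounds the second moment of the difference of the two box indicators.\<close>

definition chain_pairs :: "nat \<Rightarrow> ((nat \<Rightarrow> real) \<times> (nat \<Rightarrow> real)) set" where
  "chain_pairs k = {(b, b'). b \<in> cover q d k \<and> b' \<in> cover q d k \<union> cover q d (k - 1) \<and>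
     (\<Prod>j=1..d. b j) + (\<Prod>j=1..d. b' j) - 2 * (\<Prod>j=1..d. min (b j) (b' j)) \<le> 5 / 4 ^ k}"

definition large_deviation :: "nat \<Rightarrow> real \<Rightarrow> (nat \<Rightarrow> real) \<times> (nat \<Rightarrow> real) \<Rightarrow> 'a set" where
  "large_deviation N T p = {\<omega> \<in> space M.
     \<bar>box_count N (fst p) \<omega> - box_count N (snd p) \<omega>
        - real N * ((\<Prod>j=1..d. fst p j) - (\<Prod>j=1..d. snd p j))\<bar> \<ge> T}"

lemma finite_chain_pairs:
  assumes "d \<ge> 2"
  shows "finite (chain_pairs k)"
  by (rule finite_subset[of _ "cover q d k \<times> (cover q d k \<union> cover q d (k - 1))"])
     (auto simp: chain_pairs_def finite_cover[OF q_ge_2 assms])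

lemma card_chain_pairs_le:
  assumes d: "d \<ge> 2" and k: "k \<ge> 1"
  shows "real (card (chain_pairs k)) \<le> 2 * exp (4 * (3 + ln (real q)) * real d * real k)"
proof -
  let ?c = "3 + ln (real q)"
  have c: "?c \<ge> 0"
    using q_ge_2 by simp
  have fin: "finite (cover q d i)" for i
    by (rule finite_cover[OF q_ge_2 d])
  have le: "real (card (cover q d i)) \<le> exp (2 * ?c * real d * real k)" if "i \<le> k" for i
  proof -
    have "real d * real (i + 1) * ?c \<le> real d * (2 * real k) * ?c"
      using that k c by (intro mult_right_mono mult_left_mono) auto
    then show ?thesis
      using card_cover_le[OF q_ge_2 d, of i] by (auto simp: algebra_simps intro: order_trans)
  qed
  have "card (chain_pairs k) \<le> card (cover q d k \<times> (cover q d k \<union> cover q d (k - 1)))"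
    using fin by (intro card_mono) (auto simp: chain_pairs_def)
  also have "\<dots> \<le> card (cover q d k) * (card (cover q d k) + card (cover q d (k - 1)))"
    by (simp add: card_cartesian_product card_Un_le)
  finally have "real (card (chain_pairs k)) \<le> real (card (cover q d k)) * (real (card (cover q d k)) + real (card (cover q d (k - 1))))"
    by (simp only: of_nat_le_iff of_nat_mult[symmetric] of_nat_add[symmetric])
  also have "\<dots> \<le> exp (2 * ?c * real d * real k) * (exp (2 * ?c * real d * real k) + exp (2 * ?c * real d * real k))"
    using le by (intro mult_mono add_mono) auto
  also have "\<dots> = 2 * exp (4 * ?c * real d * real k)"
    by (simp add: exp_add[symmetric] algebra_simps)
  finally show ?thesis .
qed

lemma box_count_eq:
  "box_count N b \<omega> - box_count N b' \<omega> = (\<Sum>n=1..N. of_bool (in_box n b \<omega>) - of_bool (in_box n b' \<omega>))"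
  by (simp add: box_count_def sum_subtractf)

lemma large_deviation_event:
  assumes d: "d \<ge> 2" and p: "p \<in> chain_pairs k"
  shows "large_deviation N T p \<in> events"
proof -
  have "on_grid (cover_exp q d k) (fst p)" "on_grid (cover_exp q d k) (snd p)"
    using p on_grid_cover[OF d] by (auto simp: chain_pairs_def)
  then have [measurable]: "Measurable.pred M (in_box n (fst p))" "Measurable.pred M (in_box n (snd p))" for n
    using in_box_event(1) by (simp_all add: pred_def)
  show ?thesis
    unfolding large_deviation_def box_count_def by measurable
qed

lemma prob_large_deviation_le:
  assumes d: "d \<ge> 2" and N: "N \<ge> 1" and k: "k \<ge> 1" and p: "p \<in> chain_pairs k"
    and w: "w = sqrt (real d * ln (real d) / real N)" "w * 4 ^ k \<le> 1"
  shows "prob (large_deviation N (real N * \<tau> * (real k / 2 ^ k) * w) p)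
    \<le> 2 * exp (2 + 4 * real k * real d - \<tau> * real d * real k / 3)"
proof -
  let ?m = "cover_exp q d k"
  let ?s = "5 / 4 ^ k :: real"
  \<comment> \<open>Chosen so that \<open>l\<close> times the threshold is
    \<open>\<tau> * d * k / 3\<close>, while the second-moment term is at most
    \<open>30 / 9 * k * d\<close>. The constraint \<open>l * m \<le> 1\<close> then follows from
    \<open>2 * k * 2^k * w \<le> 1\<close>.\<close>
  define l where "l = real d * 2 ^ k / (3 * w * real N)"
  have ln_d: "ln (real d) > 0"
    using d by simp
  have w_pos: "w > 0"
    using d N ln_d by (simp add: w(1))
  have w_sq: "w * w = real d * ln (real d) / real N"
    using ln_d by (simp add: w(1))
  \<comment> \<open>Absorbs the \<open>k\<close> of the digit length, so that only
    \<open>4^k\<close> has to be compared with \<open>1 / w\<close>.\<close>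
  have k2: "2 * real k \<le> 2 ^ k"
  proof -
    have "2 * n \<le> 2 ^ n" for n :: nat
    proof (induction n)
      case (Suc n)
      then show ?case
        by (cases n) auto
    qed simp
    from this[of k] have "real (2 * k) \<le> real (2 ^ k)"
      by (simp only: of_nat_le_iff)
    then show ?thesis
      by simp
  qed
  have four: "(4 :: real) ^ k = 2 ^ k * 2 ^ k"
    by (simp add: power_mult_distrib[symmetric])
  have m: "real ?m \<le> 6 * real k * ln (real d)"
    by (rule cover_exp_le_ln[OF q_ge_2 d k])
  have lm: "l * real ?m \<le> 1"
  proof -
    have "l * real ?m \<le> l * (6 * real k * ln (real d))"
      using m w_pos by (intro mult_left_mono) (auto simp: l_def)
    also have "\<dots> = 2 * real k * 2 ^ k * (real d * ln (real d) / real N) / w"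
      by (simp add: l_def field_simps)
    also have "\<dots> = 2 * real k * 2 ^ k * w"
      using w_pos by (simp add: w_sq[symmetric])
    also have "\<dots> \<le> 2 ^ k * 2 ^ k * w"
      using k2 w_pos by (intro mult_right_mono) auto
    also have "\<dots> \<le> 1"
      using w(2) by (simp add: four mult.commute)
    finally show ?thesis .
  qed
  have var: "real N * real ?m * l\<^sup>2 * ?s \<le> 4 * real k * real d"
  proof -
    have "real N * real ?m * l\<^sup>2 * ?s = 5 * (real d * real d) * real ?m / (9 * (w * w) * real N)"
      using w_pos N by (simp add: l_def four power2_eq_square field_simps)
    also have "\<dots> = 5 * real d * real ?m / (9 * ln (real d))"
      using N d ln_d by (simp add: w_sq field_simps)
    also have "\<dots> \<le> 5 * real d * (6 * real k * ln (real d)) / (9 * ln (real d))"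
      using m ln_d by (intro divide_right_mono mult_left_mono) auto
    also have "\<dots> = 30 / 9 * (real k * real d)"
      using ln_d by simp
    also have "\<dots> \<le> 4 * (real k * real d)"
      by (intro mult_right_mono) auto
    finally show ?thesis
      by simp
  qed
  have lT: "l * (real N * \<tau> * (real k / 2 ^ k) * w) = \<tau> * real d * real k / 3"
    using w_pos N by (simp add: l_def)
  obtain b b' where bb: "p = (b, b')"
    by (cases p)
  have s2: "?s \<le> 2"
  proof -
    have "(4 :: real) ^ 1 \<le> 4 ^ k"
      using k by (intro power_increasing) auto
    then show ?thesis
      by (simp add: field_simps)
  qed
  have "prob (large_deviation N (real N * \<tau> * (real k / 2 ^ k) * w) p)
      \<le> 2 * exp (2 + real N * real ?m * l\<^sup>2 * ?s - l * (real N * \<tau> * (real k / 2 ^ k) * w))"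
    unfolding large_deviation_def bb fst_conv snd_conv box_count_eq
  proof (rule box_pair_tail_bound)
    show "on_grid ?m b" "on_grid ?m b'"
      using p on_grid_cover[OF d] by (auto simp: chain_pairs_def bb)
    show "(\<Prod>j=1..d. b j) + (\<Prod>j=1..d. b' j) - 2 * (\<Prod>j=1..d. min (b j) (b' j)) \<le> ?s"
      using p by (simp add: chain_pairs_def bb)
    show "0 < l"
      using w_pos N d by (simp add: l_def)
  qed (use cover_exp_pos[OF q_ge_2 d] s2 lm in auto)
  also have "\<dots> \<le> 2 * exp (2 + 4 * real k * real d - \<tau> * real d * real k / 3)"
    using var unfolding lT by simp
  finally show ?thesis .
qed

section \<open>Union bound over all levels and pairs\<close>

definition deviation_set :: "nat \<Rightarrow> real \<Rightarrow> real \<Rightarrow> nat \<Rightarrow> 'a set" where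
  "deviation_set N \<tau> w K = (\<Union>k\<in>{1..K}. \<Union>p\<in>chain_pairs k.
     large_deviation N (real N * \<tau> * (real k / 2 ^ k) * w) p)"

text \<open>\<tau> has one summand for each term to be beaten in the exponent:
  \<open>4 * (3 + ln q)\<close> for the number of pairs, 4 for the second moment and the logarithm
  for the target probability. The 3 undoes the \<open>1 / 3\<close> that comes from the choice of
  \<open>l\<close>.\<close>

lemma prob_deviation_set_le:
  assumes d: "d \<ge> 2" and N: "N \<ge> 1"
    and w: "w = sqrt (real d * ln (real d) / real N)" "w * 4 ^ K \<le> 1"
    and \<epsilon>: "0 < \<epsilon>" "\<epsilon> < 1"
    and \<tau>: "\<tau> = 3 * (4 * (3 + ln (real q)) + 4 + ln (8 * exp 2 / \<epsilon>))"
  shows "deviation_set N \<tau> w K \<in> events" and "prob (deviation_set N \<tau> w K) \<le> \<epsilon>"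
proof -
  let ?L = "\<lambda>k. large_deviation N (real N * \<tau> * (real k / 2 ^ k) * w)"
  \<comment> \<open>Level \<open>k\<close> contributes at most \<open>4 * exp 2 * x^k\<close>. As
    \<open>x \<le> 1 / 2\<close>, the sum is at most \<open>8 * exp 2 * x\<close>, which this choice
    makes equal to \<epsilon>.\<close>
  define x where "x = \<epsilon> / (8 * exp 2)"
  have x: "0 < x" "x \<le> 1 / 2"
  proof -
    show "0 < x"
      using \<epsilon> by (simp add: x_def)
    have "1 \<le> exp (2 :: real)"
      by simp
    then have "\<epsilon> \<le> 4 * exp 2"
      using \<epsilon> by linarith
    then show "x \<le> 1 / 2"
      by (simp add: x_def field_simps)
  qed
  have ln_x: "ln (8 * exp 2 / \<epsilon>) = - ln x"
    using \<epsilon> by (simp add: x_def ln_div ln_mult)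
  have exponent: "4 * (3 + ln (real q)) * real d * real k + (2 + 4 * real k * real d - \<tau> * real d * real k / 3)
      = 2 + real (d * k) * ln x" for k
    unfolding \<tau> ln_x by (simp add: field_simps)
  have L: "?L k p \<in> events" if "p \<in> chain_pairs k" for k p
    by (rule large_deviation_event[OF d that])
  have U: "(\<Union>p\<in>chain_pairs k. ?L k p) \<in> events" for k
    using L by (intro sets.finite_UN finite_chain_pairs d)
  show "deviation_set N \<tau> w K \<in> events"
    unfolding deviation_set_def by (rule sets.finite_UN[OF _ U]) simp
  have level: "prob (\<Union>p\<in>chain_pairs k. ?L k p) \<le> 4 * exp 2 * x ^ k" if k: "k \<in> {1..K}" for k
  proof -
    have k1: "k \<ge> 1"
      using k by simp
    have wk: "w * 4 ^ k \<le> 1"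
    proof -
      have "w * 4 ^ k \<le> w * 4 ^ K"
        using k d by (intro mult_left_mono power_increasing) (auto simp: w(1))
      then show ?thesis
        using w(2) by simp
    qed
    let ?P = "2 * exp (2 + 4 * real k * real d - \<tau> * real d * real k / 3)"
    have "prob (\<Union>p\<in>chain_pairs k. ?L k p) \<le> (\<Sum>p\<in>chain_pairs k. prob (?L k p))"
      using L by (intro measure_UNION_le finite_chain_pairs d)
    also have "\<dots> \<le> (\<Sum>p\<in>chain_pairs k. ?P)"
      by (intro sum_mono prob_large_deviation_le[OF d N k1 _ w(1) wk])
    also have "\<dots> = real (card (chain_pairs k)) * ?P"
      by simp
    also have "\<dots> \<le> 2 * exp (4 * (3 + ln (real q)) * real d * real k) * ?P"
      by (intro mult_right_mono card_chain_pairs_le d k1) auto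
    also have "\<dots> = 4 * exp (2 + real (d * k) * ln x)"
      by (simp only: exponent[symmetric] exp_add)
    also have "\<dots> = 4 * exp 2 * x ^ (d * k)"
      using x by (simp add: exp_add exp_of_nat_mult del: of_nat_mult)
    also have "\<dots> \<le> 4 * exp 2 * x ^ k"
      using x d by (intro mult_left_mono power_decreasing) auto
    finally show ?thesis .
  qed
  have "prob (deviation_set N \<tau> w K) \<le> (\<Sum>k\<in>{1..K}. prob (\<Union>p\<in>chain_pairs k. ?L k p))"
    unfolding deviation_set_def using U by (intro measure_UNION_le) auto
  also have "\<dots> \<le> (\<Sum>k\<in>{1..K}. 4 * exp 2 * x ^ k)"
    by (intro sum_mono level)
  also have "\<dots> = 4 * exp 2 * (\<Sum>k\<in>{1..K}. x ^ k)"
    by (simp add: sum_distrib_left)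
  also have "(\<Sum>k\<in>{1..K}. x ^ k) \<le> 2 * x"
  proof -
    have "(\<Sum>k\<in>{1..K}. x ^ k) = x * (\<Sum>k<K. x ^ k)"
      by (simp add: sum_distrib_left sum.atLeast1_atMost_eq)
    also have "(\<Sum>k<K. x ^ k) \<le> (\<Sum>k. x ^ k)"
      using x by (intro sum_le_suminf summable_geometric) auto
    also have "(\<Sum>k. x ^ k) = 1 / (1 - x)"
      using x by (intro suminf_geometric) auto
    also have "\<dots> \<le> 2"
      using x by (simp add: field_simps)
    finally show ?thesis
      using x by simp
  qed
  also have "4 * exp 2 * (2 * x) = \<epsilon>"
    by (simp add: x_def)
  finally show "prob (deviation_set N \<tau> w K) \<le> \<epsilon>"
    by simp
qed

section \<open>Deterministic chaining off the exceptional set\<close>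

lemma box_count_unit_box: "box_count N (\<lambda>j\<in>{1..d}. 1) \<omega> = real N"
proof -
  \<comment> \<open>Truncations stay below 1 even if all digits are \<open>q - 1\<close> and the
    point itself is 1, so the chain starts without error.\<close>
  have "in_box n (\<lambda>j\<in>{1..d}. 1) \<omega>" for n
    unfolding in_box_def using digit_nat_less[OF digit_less] q_ge_2
    by (simp add: digit_trunc_def divide_less_eq_1 of_nat_less_iff[symmetric] del: of_nat_less_iff)
  then show ?thesis
    by (simp add: box_count_def)
qed

definition digit_point :: "'a \<Rightarrow> nat \<Rightarrow> nat \<Rightarrow> real" where
  "digit_point \<omega> n j = (\<Sum>i. real (X j (n - 1 + i) \<omega>) / real q ^ Suc i)"

lemma in_box_if_point_less:
  assumes "\<And>j. j \<in> {1..d} \<Longrightarrow> digit_point \<omega> n j < t j" "\<And>j. j \<in> {1..d} \<Longrightarrow> t j \<le> b j"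
  shows "in_box n b \<omega>"
  unfolding in_box_def
proof (intro ballI allI)
  fix j m assume j: "j \<in> {1..d}"
  have "digit_trunc q (\<lambda>i. X j (n - 1 + i) \<omega>) m \<le> digit_point \<omega> n j"
    unfolding digit_point_def by (rule digit_expansion(1)[OF digit_less q_ge_2])
  then show "digit_trunc q (\<lambda>i. X j (n - 1 + i) \<omega>) m < b j"
    using assms[OF j] by linarith
qed

text \<open>Strict bounds on all truncations give only
  \<open>digit_point \<omega> n j \<le> a j\<close> in the limit; the gap between \<open>a j\<close>
  and \<open>t j\<close> restores strictness. The alternative \<open>a j = 0\<close> cannot occur,
  since the empty truncation is 0.\<close>

lemma point_less_if_in_box:
  assumes box: "in_box n a \<omega>" and a: "\<And>j. j \<in> {1..d} \<Longrightarrow> a j < t j \<or> a j = 0" and j: "j \<in> {1..d}"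
  shows "digit_point \<omega> n j < t j"
proof -
  let ?D = "digit_trunc q (\<lambda>i. X j (n - 1 + i) \<omega>)"
  have D: "?D m < a j" for m
    using box j by (simp add: in_box_def)
  have "a j \<noteq> 0"
    using D[of 0] by (simp add: digit_trunc_def)
  have lim: "?D \<longlonglongrightarrow> digit_point \<omega> n j"
    using summable_LIMSEQ[OF summable_digits[of "\<lambda>i. X j (n - 1 + i) \<omega>" q, OF digit_less q_ge_2]] q_ge_2
    unfolding digit_point_def by (subst (asm) sum_digits_eq_trunc) auto
  have "digit_point \<omega> n j \<le> a j"
    using D by (intro LIMSEQ_le_const2[OF lim] exI[of _ 0]) (auto intro: less_imp_le)
  then show ?thesis
    using a[OF j] \<open>a j \<noteq> 0\<close> by linarith
qed

text \<open>The count at \<open>t\<close> is squeezed between those of an inner and an outer box of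
  level \<open>K\<close>. The chain of outer boxes contributes \<open>2 * \<tau>\<close>, the step
  from outer to inner box contributes \<tau>, and the width \<open>4^(-K) \<le> 4 * w\<close>
  contributes 4.\<close>

lemma discrepancy_off_deviation_set:
  assumes d: "d \<ge> 2" and N: "N \<ge> 1" and \<omega>: "\<omega> \<in> space M" "\<omega> \<notin> deviation_set N \<tau> w K"
    and K: "K \<ge> 1" "1 \<le> w * 4 ^ (K + 1)" and w: "w > 0" and \<tau>: "\<tau> \<ge> 0"
    and t: "\<And>j. j \<in> {1..d} \<Longrightarrow> 0 \<le> t j \<and> t j \<le> 1"
  shows "\<bar>real (card {n \<in> {1..N}. \<forall>j\<in>{1..d}. digit_point \<omega> n j < t j}) / real N - (\<Prod>j=1..d. t j)\<bar>
    \<le> (3 * \<tau> + 4) * w"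
proof -
  let ?A = "\<lambda>b. box_count N b \<omega>" and ?V = "\<lambda>b. \<Prod>j=1..d. b j :: real"
  define B where "B = real (card {n \<in> {1..N}. \<forall>j\<in>{1..d}. digit_point \<omega> n j < t j})"
  have B_sum: "B = (\<Sum>n=1..N. of_bool (\<forall>j\<in>{1..d}. digit_point \<omega> n j < t j))"
    by (simp add: B_def Int_def)
  have good: "\<bar>?A b - ?A b' - real N * (?V b - ?V b')\<bar> \<le> real N * \<tau> * (real k / 2 ^ k) * w"
    if "k \<in> {1..K}" "(b, b') \<in> chain_pairs k" for k b b'
    using \<omega> that by (force simp: deviation_set_def large_deviation_def)
  have "\<exists>bs. \<forall>k. bs k \<in> cover q d k \<and> (\<forall>j\<in>{1..d}. t j \<le> bs k j) \<and> ?V (bs k) - ?V t \<le> 1 / 4 ^ k \<and>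
      (?V (bs k) \<le> 1 / 4 ^ k \<or> (\<exists>a\<in>cover q d k. (\<forall>j\<in>{1..d}. a j \<le> bs k j \<and> (a j < t j \<or> a j = 0))
        \<and> ?V (bs k) - ?V a \<le> 1 / 4 ^ k))"
    by (rule choice, rule allI, rule cover_bracket[OF q_ge_2 d t]) blast+
  then obtain cs where cs: "cs k \<in> cover q d k" "\<forall>j\<in>{1..d}. t j \<le> cs k j" "?V (cs k) - ?V t \<le> 1 / 4 ^ k"
      "?V (cs k) \<le> 1 / 4 ^ k \<or> (\<exists>a\<in>cover q d k. (\<forall>j\<in>{1..d}. a j \<le> cs k j \<and> (a j < t j \<or> a j = 0))
        \<and> ?V (cs k) - ?V a \<le> 1 / 4 ^ k)" for k
    by blast
  \<comment> \<open>Level 0 is replaced by the unit box, where count and expected count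
    agree.\<close>
  define bs where "bs k = (if k = 0 then (\<lambda>j\<in>{1..d}. 1) else cs k)" for k
  have V_t: "0 \<le> ?V t"
    using t by (intro prod_nonneg) auto
  have bs: "bs k \<in> cover q d k" "\<forall>j\<in>{1..d}. t j \<le> bs k j" "?V (bs k) - ?V t \<le> 1 / 4 ^ k" for k
    using cs[of k] t V_t unit_box_in_cover[OF q_ge_2 d] by (auto simp: bs_def)
  \<comment> \<open>Both corners dominate \<open>t\<close>, hence so does their minimum, and the two
    excess volumes are at most \<open>1 / 4^Suc k\<close> and \<open>4 / 4^Suc k\<close>. This is
    the 5 in \<open>chain_pairs\<close>.\<close>
  have pair: "(bs (Suc k), bs k) \<in> chain_pairs (Suc k)" for k
  proof -
    have "?V t \<le> (\<Prod>j=1..d. min (bs (Suc k) j) (bs k j))"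
      using t bs(2)[of k] bs(2)[of "Suc k"] by (intro prod_mono) auto
    moreover have "1 / 4 ^ k = 4 * (1 / 4 ^ Suc k :: real)"
      by simp
    ultimately have "?V (bs (Suc k)) + ?V (bs k) - 2 * (\<Prod>j=1..d. min (bs (Suc k) j) (bs k j)) \<le> 5 / 4 ^ Suc k"
      using bs(3)[of k] bs(3)[of "Suc k"] by linarith
    then show ?thesis
      using bs(1)[of k] bs(1)[of "Suc k"] by (simp add: chain_pairs_def)
  qed
  \<comment> \<open>\<open>2 - (k + 2) / 2^k\<close> is the sum of \<open>i / 2^i\<close> over
    \<open>i \<le> k\<close>.\<close>
  have chain: "\<bar>?A (bs k) - real N * ?V (bs k)\<bar> \<le> real N * \<tau> * w * (2 - (real k + 2) / 2 ^ k)" if "k \<le> K" for k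
    using that
  proof (induction k)
    case 0
    have "?A (bs 0) = real N"
      by (simp only: bs_def refl if_True box_count_unit_box)
    moreover have "?V (bs 0) = 1"
      by (simp add: bs_def)
    ultimately show ?case
      by simp
  next
    case (Suc k)
    have "\<bar>?A (bs (Suc k)) - ?A (bs k) - real N * (?V (bs (Suc k)) - ?V (bs k))\<bar>
        \<le> real N * \<tau> * (real (Suc k) / 2 ^ Suc k) * w"
      using Suc.prems by (intro good pair) auto
    moreover have "\<bar>?A (bs k) - real N * ?V (bs k)\<bar> \<le> real N * \<tau> * w * (2 - (real k + 2) / 2 ^ k)"
      using Suc by simp
    ultimately have "\<bar>?A (bs (Suc k)) - real N * ?V (bs (Suc k))\<bar>
        \<le> real N * \<tau> * w * (2 - (real k + 2) / 2 ^ k) + real N * \<tau> * (real (Suc k) / 2 ^ Suc k) * w"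
      by (simp only: right_diff_distrib)
    also have "\<dots> = real N * \<tau> * w * (2 - (real (Suc k) + 2) / 2 ^ Suc k)"
      by (simp add: field_simps)
    finally show ?case .
  qed
  have NTw: "0 \<le> real N * \<tau> * w"
    using \<tau> w by simp
  have "real N * \<tau> * w * (2 - (real K + 2) / 2 ^ K) \<le> real N * \<tau> * w * 2"
    using NTw by (intro mult_left_mono) auto
  then have chain_K: "\<bar>?A (bs K) - real N * ?V (bs K)\<bar> \<le> 2 * (real N * \<tau> * w)"
    using chain[of K] by linarith
  have small: "1 / 4 ^ K \<le> 4 * w"
    using K(2) by (simp add: field_simps)
  have N_small: "real N * (1 / 4 ^ K) \<le> real N * (4 * w)"
    using small by (intro mult_left_mono) auto
  have "in_box n (bs K) \<omega>" if "\<forall>j\<in>{1..d}. digit_point \<omega> n j < t j" for n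
    using that bs(2)[of K] by (intro in_box_if_point_less[where t = t]) auto
  then have B_le: "B \<le> ?A (bs K)"
    unfolding B_sum box_count_def by (intro sum_mono) (simp add: of_bool_def)
  have "real N * ?V (bs K) - real N * ?V t \<le> real N * (1 / 4 ^ K)"
    using bs(3)[of K] mult_left_mono[of "?V (bs K) - ?V t" "1 / 4 ^ K" "real N"] by (simp add: right_diff_distrib)
  then have upper: "B - real N * ?V t \<le> real N * (4 * w) + 2 * (real N * \<tau> * w)"
    using B_le chain_K N_small by linarith
  have B_nonneg: "0 \<le> B"
    by (simp add: B_def)
  have lower: "- (real N * (4 * w) + 3 * (real N * \<tau> * w)) \<le> B - real N * ?V t"
  proof (cases "?V (bs K) \<le> 1 / 4 ^ K")
    \<comment> \<open>Here the box at \<open>t\<close> has volume at most \<open>4^(-K)\<close>, so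
      \<open>B \<ge> 0\<close> is already a sufficient lower bound.\<close>
    case True
    have "?V t \<le> ?V (bs K)"
      using t bs(2)[of K] by (intro prod_mono) auto
    then have "?V t \<le> 1 / 4 ^ K"
      using True by linarith
    then have "real N * ?V t \<le> real N * (1 / 4 ^ K)"
      by (intro mult_left_mono) auto
    then show ?thesis
      using N_small B_nonneg NTw by linarith
  next
    case False
    have bsK: "bs K = cs K"
      using K(1) by (simp add: bs_def)
    obtain a where a: "a \<in> cover q d K" "\<forall>j\<in>{1..d}. a j \<le> bs K j \<and> (a j < t j \<or> a j = 0)"
        "?V (bs K) - ?V a \<le> 1 / 4 ^ K"
      using cs(4)[of K] False unfolding bsK by blast
    \<comment> \<open>The inner box is contained in the outer one, so the second moment is the
      difference of the volumes. For such pairs \<open>chain_pairs\<close> also admits two corners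
      of the same level.\<close>
    have "(\<Prod>j=1..d. min (bs K j) (a j)) = ?V a"
      using a(2) by (intro prod.cong refl min_absorb2) auto
    then have "(bs K, a) \<in> chain_pairs K"
      using a(1,3) bs(1)[of K] by (simp add: chain_pairs_def field_simps)
    then have "\<bar>?A (bs K) - ?A a - real N * (?V (bs K) - ?V a)\<bar> \<le> real N * \<tau> * (real K / 2 ^ K) * w"
      using K(1) by (intro good) auto
    also have "\<dots> = real N * \<tau> * w * (real K / 2 ^ K)"
      by simp
    also have "\<dots> \<le> real N * \<tau> * w * 1"
    proof (rule mult_left_mono[OF _ NTw])
      have "real K \<le> 2 ^ K"
        using of_nat_less_two_power[of K] by (rule less_imp_le)
      then show "real K / 2 ^ K \<le> 1"
        by simp
    qed
    finally have dev: "\<bar>?A (bs K) - ?A a - real N * (?V (bs K) - ?V a)\<bar> \<le> real N * \<tau> * w"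
      by simp
    have "\<forall>j\<in>{1..d}. digit_point \<omega> n j < t j" if "in_box n a \<omega>" for n
      using point_less_if_in_box[OF that] a(2) by blast
    then have A_le: "?A a \<le> B"
      unfolding B_sum box_count_def by (intro sum_mono) (simp add: of_bool_def)
    have "?V t \<le> ?V (bs K)"
      using t bs(2)[of K] by (intro prod_mono) auto
    then have "real N * ?V t \<le> real N * ?V (bs K)"
      by (intro mult_left_mono) auto
    moreover have "real N * ?V (bs K) - real N * ?V a \<le> real N * (1 / 4 ^ K)"
      using mult_left_mono[OF a(3), of "real N"] by (simp add: right_diff_distrib)
    moreover have "real N * (?V (bs K) - ?V a) = real N * ?V (bs K) - real N * ?V a"
      by (rule right_diff_distrib)
    ultimately show ?thesis
      using dev A_le chain_K N_small by linarith
  qed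
  have "\<bar>B - real N * ?V t\<bar> \<le> real N * ((3 * \<tau> + 4) * w)"
    using upper lower NTw by (simp add: abs_le_iff algebra_simps)
  moreover have "B / real N - ?V t = (B - real N * ?V t) / real N"
    using N by (simp add: field_simps)
  ultimately have "\<bar>B / real N - ?V t\<bar> \<le> (3 * \<tau> + 4) * w"
    using N by (simp add: abs_divide pos_divide_le_eq mult.commute)
  then show ?thesis
    by (simp only: B_def)
qed

end

section \<open>The digits of a Haar distributed series\<close>

definition haar_digit :: "nat \<Rightarrow> nat \<Rightarrow> (nat \<Rightarrow> 'q::prime_card mod_ring fls) \<Rightarrow> nat" where
  "haar_digit j i f = nat (to_int_mod_ring (fls_nth (f j) (int (Suc i))))"

lemma to_int_mod_ring_bounds:
  "0 \<le> to_int_mod_ring (x :: 'q::finite mod_ring)" "to_int_mod_ring x < int CARD('q)"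
  using range_to_int_mod_ring[where 'a = 'q] by (auto dest: equalityD1 simp: subset_iff)

lemma haar_digit_less: "haar_digit j i (f :: nat \<Rightarrow> 'q::prime_card mod_ring fls) < CARD('q)"
  using to_int_mod_ring_bounds[of "fls_nth (f j) (int (Suc i))"] by (simp add: haar_digit_def nat_less_iff)

text \<open>Multiplication by \<open>t^(n - 1)\<close> shifts the coefficients by
  \<open>n - 1\<close> places, and the fractional part drops those that move into the polynomial
  part.\<close>

lemma kronecker_point_eq:
  fixes f :: "nat \<Rightarrow> 'q::prime_card mod_ring fls"
  assumes "j \<in> {1..d}"
  shows "kronecker_point d f n j = (\<Sum>i. real (haar_digit j (n - 1 + i) f) / real CARD('q) ^ Suc i)"
proof -
  have "fls_X_inv ^ k * g = fls_shift (int k) g" for k :: nat and g :: "'q mod_ring fls"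
    by (simp add: fls_X_inv_power_conv_shift_1 fls_shifted_times_simps)
  then have "fls_nth (fls_frac (fls_X_inv ^ (n - 1) * f j)) (int (Suc i)) = fls_nth (f j) (int (Suc (n - 1 + i)))" for i
    by (simp add: fls_frac.rep_eq algebra_simps)
  moreover have "real_of_int (to_int_mod_ring x) = real (nat (to_int_mod_ring x))" for x :: "'q mod_ring"
    using to_int_mod_ring_bounds[of x] by simp
  ultimately show ?thesis
    using assms by (simp only: kronecker_point_def restrict_apply if_True frac_to_real_def haar_digit_def)
qed

text \<open>\<open>borel_cylinder\<close> concerns sets prescribing all coefficients up to some
  index; one coefficient is reached by a union over the finitely many values of the earlier
  ones.\<close>

lemma measurable_fls_nth:
  "(\<lambda>g. fls_nth g (int (Suc i))) \<in> measurable (frac_haar :: 'q::prime_card mod_ring fls measure) (count_space UNIV)"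
proof (subst measurable_count_space_eq2, simp, intro conjI ballI)
  fix a :: "'q mod_ring"
  let ?W = "{w \<in> {1..Suc i} \<rightarrow>\<^sub>E UNIV. w (Suc i) = a}"
  have "finite ?W"
    by (rule finite_subset[of _ "{1..Suc i} \<rightarrow>\<^sub>E UNIV"]) (auto intro!: finite_PiE)
  then have "(\<Union>w\<in>?W. {g \<in> frac_series. \<forall>k\<in>{1..Suc i}. fls_nth g (int k) = w k}) \<in> sets frac_haar"
    unfolding sets_frac_haar by (intro sets.finite_UN borel_cylinder)
  also have "(\<Union>w\<in>?W. {g \<in> frac_series. \<forall>k\<in>{1..Suc i}. fls_nth g (int k) = w k})
      = (\<lambda>g. fls_nth g (int (Suc i))) -` {a} \<inter> space frac_haar" (is "?L = ?R")
  proof (intro Set.set_eqI iffI)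
    fix g assume g: "g \<in> ?R"
    let ?w = "\<lambda>k\<in>{1..Suc i}. fls_nth g (int k)"
    have "?w \<in> ?W" "g \<in> {g \<in> frac_series. \<forall>k\<in>{1..Suc i}. fls_nth g (int k) = ?w k}"
      using g by (auto simp: space_frac_haar)
    then show "g \<in> ?L"
      by blast
  qed (auto simp: space_frac_haar simp del: of_nat_Suc)
  finally show "(\<lambda>g. fls_nth g (int (Suc i))) -` {a} \<inter> space frac_haar \<in> sets frac_haar" .
qed simp

abbreviation uniform_digit :: "'q::prime_card mod_ring pmf" where
  "uniform_digit \<equiv> pmf_of_set UNIV"

lemma measure_frac_haar_digits:
  assumes "finite J"
  shows "measure (frac_haar :: 'q::prime_card mod_ring fls measure)
      {g \<in> space frac_haar. \<forall>i\<in>J. fls_nth g (int (Suc i)) \<in> A i} = (\<Prod>i\<in>J. measure uniform_digit (A i))"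
proof -
  interpret product_prob_space "\<lambda>_ :: nat. measure_pmf (uniform_digit :: 'q mod_ring pmf)" UNIV
    by unfold_locales
  let ?A = "{g \<in> space frac_haar. \<forall>i\<in>J. fls_nth g (int (Suc i)) \<in> A i}"
  note [measurable] = measurable_fls_nth
  have "?A \<in> sets frac_haar"
    using assms by measurable
  then have A: "?A \<in> sets (restrict_space borel frac_series)"
    by (simp only: sets_frac_haar)
  have "measure frac_haar ?A = measure digit_space (digit_series -` ?A \<inter> space digit_space)"
    by (subst frac_haar_def, rule measure_distr[OF measurable_digit_series A])
  also have "digit_series -` ?A \<inter> space digit_space
      = prod_emb UNIV (\<lambda>_. measure_pmf uniform_digit) J (\<Pi>\<^sub>E i\<in>J. A i)"
  proof -
    have "fls_nth (digit_series c) (int (Suc i)) = c i" for c :: "nat \<Rightarrow> 'q mod_ring" and i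
      by (simp add: digit_series.rep_eq)
    then have "digit_series -` ?A \<inter> space digit_space = {c. \<forall>i\<in>J. c i \<in> A i}"
      by (simp add: vimage_def space_PiM PiE_UNIV_domain space_frac_haar)
    also have "\<dots> = prod_emb UNIV (\<lambda>_. measure_pmf uniform_digit) J (\<Pi>\<^sub>E i\<in>J. A i)"
      by (auto simp: prod_emb_def PiE_UNIV_domain vimage_def restrict_PiE_iff)
    finally show ?thesis .
  qed
  also have "measure digit_space \<dots> = (\<Prod>i\<in>J. measure uniform_digit (A i))"
    using assms by (intro measure_PiM_emb) auto
  finally show ?thesis .
qed

section \<open>Joint law of the digits of all coordinates\<close>

abbreviation haar_product :: "nat \<Rightarrow> (nat \<Rightarrow> 'q::prime_card mod_ring fls) measure" where
  "haar_product d \<equiv> (\<Pi>\<^sub>M j\<in>{1..d}. frac_haar)"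

lemma prob_space_haar_product: "prob_space (haar_product d :: (nat \<Rightarrow> 'q::prime_card mod_ring fls) measure)"
  by (intro prob_space_PiM prob_space_frac_haar)

text \<open>Slicing \<open>J\<close> by coordinate turns the event into a product of events in the
  factors; the double product over the slices is then reassembled over \<open>J\<close>.\<close>

lemma measure_haar_product_digits:
  assumes J: "finite J" "J \<subseteq> {1..d} \<times> UNIV"
  shows "measure (haar_product d :: (nat \<Rightarrow> 'q::prime_card mod_ring fls) measure)
      {f \<in> space (haar_product d). \<forall>p\<in>J. fls_nth (f (fst p)) (int (Suc (snd p))) \<in> A p}
    = (\<Prod>p\<in>J. measure uniform_digit (A p))"
proof -
  interpret finite_product_prob_space "\<lambda>_ :: nat. frac_haar :: 'q mod_ring fls measure" "{1..d}"
    by (intro finite_product_prob_space.intro finite_product_sigma_finite.intro product_prob_space.intro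
          product_sigma_finite.intro finite_product_sigma_finite_axioms.intro product_prob_space_axioms.intro
          prob_space_frac_haar prob_space_imp_sigma_finite) auto
  let ?J = "\<lambda>j. {i. (j, i) \<in> J}"
  let ?B = "\<lambda>j. {g \<in> space (frac_haar :: 'q mod_ring fls measure). \<forall>i\<in>?J j. fls_nth g (int (Suc i)) \<in> A (j, i)}"
  have fin: "finite (?J j)" for j
    using finite_vimageI[OF J(1), of "Pair j"] by (simp add: vimage_def inj_on_def)
  note [measurable] = measurable_fls_nth
  have B: "?B j \<in> sets frac_haar" for j
    using fin by measurable
  have "{f \<in> space (haar_product d). \<forall>p\<in>J. fls_nth (f (fst p)) (int (Suc (snd p))) \<in> A p} = (\<Pi>\<^sub>E j\<in>{1..d}. ?B j)"
    
  proof (rule Set.set_eqI)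
    fix f :: "nat \<Rightarrow> 'q mod_ring fls"
    have "(\<forall>p\<in>J. fls_nth (f (fst p)) (int (Suc (snd p))) \<in> A p)
        \<longleftrightarrow> (\<forall>j\<in>{1..d}. \<forall>i\<in>?J j. fls_nth (f j) (int (Suc i)) \<in> A (j, i))"
    proof
      assume *: "\<forall>j\<in>{1..d}. \<forall>i\<in>?J j. fls_nth (f j) (int (Suc i)) \<in> A (j, i)"
      show "\<forall>p\<in>J. fls_nth (f (fst p)) (int (Suc (snd p))) \<in> A p"
      proof
        fix p assume "p \<in> J"
        moreover obtain j i where "p = (j, i)"
          by (cases p)
        ultimately show "fls_nth (f (fst p)) (int (Suc (snd p))) \<in> A p"
          using J(2) * by (simp only: fst_conv snd_conv) blast
      qed
    next
      assume *: "\<forall>p\<in>J. fls_nth (f (fst p)) (int (Suc (snd p))) \<in> A p"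
      show "\<forall>j\<in>{1..d}. \<forall>i\<in>?J j. fls_nth (f j) (int (Suc i)) \<in> A (j, i)"
      proof (intro ballI)
        fix j i assume "i \<in> ?J j"
        then have "(j, i) \<in> J"
          by simp
        from bspec[OF * this] show "fls_nth (f j) (int (Suc i)) \<in> A (j, i)"
          by (simp only: fst_conv snd_conv)
      qed
    qed
    then show "f \<in> {f \<in> space (haar_product d). \<forall>p\<in>J. fls_nth (f (fst p)) (int (Suc (snd p))) \<in> A p}
        \<longleftrightarrow> f \<in> (\<Pi>\<^sub>E j\<in>{1..d}. ?B j)"
      by (simp only: mem_Collect_eq space_PiM PiE_iff) blast
  qed
  then have "measure (haar_product d)
      {f \<in> space (haar_product d). \<forall>p\<in>J. fls_nth (f (fst p)) (int (Suc (snd p))) \<in> A p}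
      = (\<Prod>j\<in>{1..d}. measure frac_haar (?B j))"
    using prob_times[of ?B] B by simp
  also have "\<dots> = (\<Prod>j\<in>{1..d}. \<Prod>i\<in>?J j. measure uniform_digit (A (j, i)))"
    by (simp only: measure_frac_haar_digits[OF fin])
  also have "\<dots> = (\<Prod>p\<in>Sigma {1..d} ?J. measure uniform_digit (A p))"
    using fin by (subst prod.Sigma) auto
  also have "Sigma {1..d} ?J = J"
    using J(2) by auto
  finally show ?thesis .
qed

lemma measure_uniform_digit:
  assumes "a < CARD('q)"
  shows "measure (uniform_digit :: 'q::prime_card mod_ring pmf) {x. nat (to_int_mod_ring x) = a} = 1 / real CARD('q)"
proof -
  have "{x :: 'q mod_ring. nat (to_int_mod_ring x) = a} = {of_int_mod_ring (int a)}"
  proof (intro Set.set_eqI iffI)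
    fix x :: "'q mod_ring"
    assume "x \<in> {x. nat (to_int_mod_ring x) = a}"
    then have "to_int_mod_ring x = int a"
      using to_int_mod_ring_bounds[of x] by auto
    then show "x \<in> {of_int_mod_ring (int a)}"
      by (metis of_int_mod_ring_to_int_mod_ring singletonI)
  qed (use assms in simp)
  then show ?thesis
    by (simp add: measure_pmf_of_set CARD_mod_ring)
qed

lemma measurable_haar_coeff:
  assumes "j \<in> {1..d}"
  shows "(\<lambda>f. fls_nth (f j) (int (Suc i))) \<in> measurable (haar_product d :: (nat \<Rightarrow> 'q::prime_card mod_ring fls) measure) (count_space UNIV)"
  using measurable_compose[OF measurable_component_singleton[OF assms] measurable_fls_nth] .

text \<open>All finite joint laws are products by \<open>measure_haar_product_digits\<close>, and
  its singleton case identifies the factors as marginal probabilities. This is independence of the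
  coefficients, which passes to their integer representatives.\<close>

lemma uniform_digits_haar:
  "uniform_digits (haar_product d :: (nat \<Rightarrow> 'q::prime_card mod_ring fls) measure) d CARD('q) haar_digit"
proof -
  let ?M = "haar_product d :: (nat \<Rightarrow> 'q mod_ring fls) measure"
  interpret prob_space ?M
    by (rule prob_space_haar_product)
  let ?D = "\<lambda>p f. fls_nth (f (fst p)) (int (Suc (snd p))) :: 'q mod_ring"
  have D: "?D p \<in> measurable ?M (count_space UNIV)" if "p \<in> {1..d} \<times> UNIV" for p
    using that by (intro measurable_haar_coeff) auto
  have single: "prob {f \<in> space ?M. ?D p f \<in> A} = measure uniform_digit A" if "p \<in> {1..d} \<times> UNIV" for p A
    using measure_haar_product_digits[of "{p}" d "\<lambda>_. A"] that by simp
  have "indep_vars (\<lambda>_. count_space UNIV) ?D ({1..d} \<times> UNIV)"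
    unfolding indep_vars_def2 indep_sets_def
  proof (intro conjI ballI allI impI)
    fix J A
    assume J: "J \<subseteq> {1..d} \<times> (UNIV :: nat set)" "J \<noteq> {}" "finite J"
      and A: "A \<in> (\<Pi> p\<in>J. {?D p -` B \<inter> space ?M |B. B \<in> sets (count_space UNIV)})"
    have "\<exists>B. A p = {f \<in> space ?M. ?D p f \<in> B}" if p: "p \<in> J" for p
    proof -
      obtain B where "A p = ?D p -` B \<inter> space ?M"
        using Pi_mem[OF A p] by blast
      then have "A p = {f \<in> space ?M. ?D p f \<in> B}"
        by (simp only: vimage_def Int_def mem_Collect_eq conj_commute)
      then show ?thesis ..
    qed
    then have "\<exists>B. \<forall>p\<in>J. A p = {f \<in> space ?M. ?D p f \<in> B p}"
      by (intro bchoice ballI)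
    then obtain B where "\<forall>p\<in>J. A p = {f \<in> space ?M. ?D p f \<in> B p}" ..
    then have B: "A p = {f \<in> space ?M. ?D p f \<in> B p}" if "p \<in> J" for p
      using that by (rule bspec)
    have "(\<Inter>p\<in>J. A p) = {f \<in> space ?M. \<forall>p\<in>J. ?D p f \<in> B p}"
      using B J(2) by auto
    then have "prob (\<Inter>p\<in>J. A p) = (\<Prod>p\<in>J. measure uniform_digit (B p))"
      by (simp only: measure_haar_product_digits[OF J(3,1)])
    also have "\<dots> = (\<Prod>p\<in>J. prob (A p))"
      using J(1) by (intro prod.cong refl) (simp only: B single subset_iff)
    finally show "prob (\<Inter>p\<in>J. A p) = (\<Prod>p\<in>J. prob (A p))" .
  next
    fix p assume p: "p \<in> {1..d} \<times> (UNIV :: nat set)"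
    show "?D p \<in> measurable ?M (count_space UNIV)"
      by (rule D[OF p])
    show "{?D p -` B \<inter> space ?M |B. B \<in> sets (count_space UNIV)} \<subseteq> events"
      using measurable_sets[OF D[OF p]] by blast
  qed
  then have indep: "indep_vars (\<lambda>_. count_space UNIV) (\<lambda>p. haar_digit (fst p) (snd p)) ({1..d} \<times> UNIV)"
    unfolding haar_digit_def by (rule indep_vars_compose2) simp
  show ?thesis
  proof unfold_locales
    have "prime CARD('q)"
      by (rule prime_card)
    then show "CARD('q) \<ge> 2"
      by (rule prime_ge_2_nat)
    show "prob {f \<in> space ?M. haar_digit j i f = a} = 1 / real CARD('q)" if "j \<in> {1..d}" "a < CARD('q)" for j i a
      using single[of "(j, i)" "{x. nat (to_int_mod_ring x) = a}"] that
      by (simp add: haar_digit_def measure_uniform_digit)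
  qed (rule haar_digit_less indep)+
qed

section \<open>The star discrepancy as a random variable\<close>

text \<open>The points in question are nonnegative, so membership in an anchored box is stated as an
  upper condition only.\<close>

definition box_deviation :: "nat \<Rightarrow> nat \<Rightarrow> (nat \<Rightarrow> nat \<Rightarrow> real) \<Rightarrow> (nat \<Rightarrow> real) \<Rightarrow> real" where
  "box_deviation d N x t =
     \<bar>real (card {n \<in> {1..N}. \<forall>j\<in>{1..d}. x n j < t j}) / real N - (\<Prod>j=1..d. t j)\<bar>"

lemma box_deviation_le_1:
  assumes "t \<in> {1..d} \<rightarrow>\<^sub>E {0..1}"
  shows "box_deviation d N x t \<le> 1"
proof -
  let ?c = "real (card {n \<in> {1..N}. \<forall>j\<in>{1..d}. x n j < t j}) / real N"
  have "card {n \<in> {1..N}. \<forall>j\<in>{1..d}. x n j < t j} \<le> card {1..N}"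
    by (intro card_mono) auto
  then have "0 \<le> ?c" "?c \<le> 1"
    by (auto simp: divide_le_eq)
  moreover have "0 \<le> (\<Prod>j=1..d. t j)" "(\<Prod>j=1..d. t j) \<le> 1"
    using assms by (auto intro!: prod_nonneg prod_le_1 simp: PiE_iff)
  ultimately show ?thesis
    unfolding box_deviation_def by linarith
qed

lemma star_discrepancy_le_iff:
  assumes x: "\<And>n. x n \<in> extensional {1..d}" "\<And>n j. j \<in> {1..d} \<Longrightarrow> 0 \<le> x n j"
  shows "star_discrepancy d N x \<le> c \<longleftrightarrow> (\<forall>t\<in>{1..d} \<rightarrow>\<^sub>E {0..1}. box_deviation d N x t \<le> c)"
proof -
  have "x n \<in> anchored_box d t \<longleftrightarrow> (\<forall>j\<in>{1..d}. x n j < t j)" for n t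
    using x by (auto simp: anchored_box_def PiE_iff)
  then have "star_discrepancy d N x = (SUP t\<in>{1..d} \<rightarrow>\<^sub>E {0..1}. box_deviation d N x t)"
    unfolding star_discrepancy_def box_deviation_def by (intro SUP_cong refl) (simp only: measure_anchored_box)
  moreover have "bdd_above (box_deviation d N x ` ({1..d} \<rightarrow>\<^sub>E {0..1}))"
    using box_deviation_le_1 by (auto intro!: bdd_aboveI[of _ 1])
  moreover have "{1..d} \<rightarrow>\<^sub>E {0..1 :: real} \<noteq> {}"
    by (simp add: PiE_eq_empty_iff)
  ultimately show ?thesis
    by (simp add: cSUP_le_iff)
qed

text \<open>Boxes are half open, so the deviation is continuous under approximation of the corner from
  below, and corners with dyadic coordinates suffice.\<close>

lemma box_deviation_rational:
  assumes "\<forall>t\<in>{1..d} \<rightarrow>\<^sub>E {0..1} \<inter> \<rat>. box_deviation d N x t \<le> c" and t: "t \<in> {1..d} \<rightarrow>\<^sub>E {0..1}"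
  shows "box_deviation d N x t \<le> c"
proof -
  define s where "s i = (\<lambda>j\<in>{1..d}. real_of_int \<lfloor>t j * 2 ^ i\<rfloor> / 2 ^ i)" for i :: nat
  have t01: "0 \<le> t j" "t j \<le> 1" if "j \<in> {1..d}" for j
    using t that by (auto simp: PiE_iff)
  have s_le: "s i j \<le> t j" and s_ge: "t j - (1 / 2) ^ i \<le> s i j" if "j \<in> {1..d}" for i j
  proof -
    have "real_of_int \<lfloor>t j * 2 ^ i\<rfloor> \<le> t j * 2 ^ i" "t j * 2 ^ i - 1 \<le> real_of_int \<lfloor>t j * 2 ^ i\<rfloor>"
      by linarith+
    then have "real_of_int \<lfloor>t j * 2 ^ i\<rfloor> / 2 ^ i \<le> t j * 2 ^ i / 2 ^ i"
        "(t j * 2 ^ i - 1) / 2 ^ i \<le> real_of_int \<lfloor>t j * 2 ^ i\<rfloor> / 2 ^ i"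
      by (intro divide_right_mono; simp)+
    then show "s i j \<le> t j" "t j - (1 / 2) ^ i \<le> s i j"
      using that by (simp_all add: s_def diff_divide_distrib power_one_over)
  qed
  have s: "s i \<in> {1..d} \<rightarrow>\<^sub>E {0..1} \<inter> \<rat>" for i
  proof -
    have "0 \<le> s i j" if "j \<in> {1..d}" for j
      using t01[OF that] that by (simp add: s_def)
    moreover have "s i j \<le> 1" if "j \<in> {1..d}" for j
      using s_le[OF that] t01[OF that] order_trans by blast
    ultimately show ?thesis
      by (auto simp: s_def PiE_iff)
  qed
  have lim: "(\<lambda>i. s i j) \<longlonglongrightarrow> t j" if "j \<in> {1..d}" for j
  proof (rule tendsto_sandwich)
    have "(\<lambda>i. (1 / 2) ^ i :: real) \<longlonglongrightarrow> 0"
      by (intro LIMSEQ_power_zero) simp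
    then show "(\<lambda>i. t j - (1 / 2) ^ i) \<longlonglongrightarrow> t j"
      using tendsto_diff[OF tendsto_const, of _ 0 sequentially "t j"] by simp
    show "\<forall>\<^sub>F i in sequentially. t j - (1 / 2) ^ i \<le> s i j" "\<forall>\<^sub>F i in sequentially. s i j \<le> t j"
      using s_le[OF that] s_ge[OF that] by auto
  qed auto
  \<comment> \<open>Each of the finitely many comparisons stabilises: one that holds for
    \<open>t j\<close> holds eventually for \<open>s i j\<close>, by convergence, and one that fails
    for \<open>t j\<close> fails for every \<open>s i j \<le> t j\<close>.\<close>
  have ev: "\<forall>\<^sub>F i in sequentially. \<forall>n\<in>{1..N}. \<forall>j\<in>{1..d}. x n j < s i j \<longleftrightarrow> x n j < t j"
  proof (intro eventually_ball_finite ballI finite_atLeastAtMost)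
    fix n j assume j: "j \<in> {1..d}"
    show "\<forall>\<^sub>F i in sequentially. x n j < s i j \<longleftrightarrow> x n j < t j"
    proof (cases "x n j < t j")
      case True
      then show ?thesis
        using order_tendstoD(1)[OF lim[OF j]] by (auto elim: eventually_mono)
    next
      case False
      then have "\<not> x n j < s i j" for i
        using s_le[OF j, of i] by linarith
      with False show ?thesis
        by simp
    qed
  qed
  let ?c = "real (card {n \<in> {1..N}. \<forall>j\<in>{1..d}. x n j < t j}) / real N"
  have "\<forall>\<^sub>F i in sequentially. \<bar>?c - (\<Prod>j=1..d. s i j)\<bar> \<le> c"
    using ev
  proof (rule eventually_mono)
    fix i assume "\<forall>n\<in>{1..N}. \<forall>j\<in>{1..d}. x n j < s i j \<longleftrightarrow> x n j < t j"
    then have "{n \<in> {1..N}. \<forall>j\<in>{1..d}. x n j < s i j} = {n \<in> {1..N}. \<forall>j\<in>{1..d}. x n j < t j}"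
      by blast
    then have "box_deviation d N x (s i) = \<bar>?c - (\<Prod>j=1..d. s i j)\<bar>"
      by (simp only: box_deviation_def)
    then show "\<bar>?c - (\<Prod>j=1..d. s i j)\<bar> \<le> c"
      using bspec[OF assms(1) s[of i]] by (simp only:)
  qed
  moreover have "(\<lambda>i. \<bar>?c - (\<Prod>j=1..d. s i j)\<bar>) \<longlonglongrightarrow> \<bar>?c - (\<Prod>j=1..d. t j)\<bar>"
    by (intro tendsto_intros lim)
  ultimately show ?thesis
    unfolding box_deviation_def by (intro tendsto_upperbound[where F = sequentially]) auto
qed

text \<open>\<open>measure\<close> is 0 outside the sigma algebra, so a lower bound on the
  probability needs measurability. Rational corners make the intersection over \<open>t\<close>
  countable.\<close>

lemma box_deviation_event:
  assumes x: "\<And>n j. j \<in> {1..d} \<Longrightarrow> (\<lambda>\<omega>. x \<omega> n j) \<in> borel_measurable M"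
  shows "{\<omega> \<in> space M. \<forall>t\<in>{1..d} \<rightarrow>\<^sub>E {0..1}. box_deviation d N (x \<omega>) t \<le> c} \<in> sets M"
proof -
  let ?T = "{1..d} \<rightarrow>\<^sub>E {0..1} \<inter> \<rat> :: (nat \<Rightarrow> real) set"
  have T: "countable ?T"
    by (intro countable_PiE countable_Int2 countable_rat) auto
  have T_nonempty: "?T \<noteq> {}"
  proof -
    have "(\<lambda>j\<in>{1..d}. 0) \<in> ?T"
      by auto
    then show ?thesis
      by blast
  qed
  have [measurable]: "(\<lambda>\<omega>. box_deviation d N (x \<omega>) t) \<in> borel_measurable M" for t
  proof -
    have "Measurable.pred M (\<lambda>\<omega>. \<forall>j\<in>{1..d}. x \<omega> n j < t j)" for n
      using x by (intro pred_intros_finite) (auto intro!: borel_measurable_pred_less)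
    then have "(\<lambda>\<omega>. \<Sum>n=1..N. if \<forall>j\<in>{1..d}. x \<omega> n j < t j then 1 else 0 :: real) \<in> borel_measurable M"
      by (intro borel_measurable_sum measurable_If) (auto simp: pred_def)
    moreover have "real (card {n \<in> {1..N}. \<forall>j\<in>{1..d}. x \<omega> n j < t j})
        = (\<Sum>n=1..N. if \<forall>j\<in>{1..d}. x \<omega> n j < t j then 1 else 0)" for \<omega>
      by (simp add: sum.If_cases Int_def)
    ultimately show ?thesis
      unfolding box_deviation_def by simp
  qed
  have "{\<omega> \<in> space M. \<forall>t\<in>{1..d} \<rightarrow>\<^sub>E {0..1}. box_deviation d N (x \<omega>) t \<le> c}
      = {\<omega> \<in> space M. \<forall>t\<in>?T. box_deviation d N (x \<omega>) t \<le> c}"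
  proof (intro Collect_cong conj_cong refl iffI)
    fix \<omega> assume "\<forall>t\<in>{1..d} \<rightarrow>\<^sub>E {0..1}. box_deviation d N (x \<omega>) t \<le> c"
    then show "\<forall>t\<in>?T. box_deviation d N (x \<omega>) t \<le> c"
      by (auto simp: PiE_iff)
  next
    fix \<omega> assume "\<forall>t\<in>?T. box_deviation d N (x \<omega>) t \<le> c"
    then show "\<forall>t\<in>{1..d} \<rightarrow>\<^sub>E {0..1}. box_deviation d N (x \<omega>) t \<le> c"
      using box_deviation_rational by blast
  qed
  also have "\<dots> = (\<Inter>t\<in>?T. {\<omega> \<in> space M. box_deviation d N (x \<omega>) t \<le> c})"
    using T_nonempty by blast
  also have "\<dots> \<in> sets M"
  proof (rule sets.countable_INT'[OF T T_nonempty], intro image_subsetI)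
    show "{\<omega> \<in> space M. box_deviation d N (x \<omega>) t \<le> c} \<in> sets M" for t
      by measurable
  qed
  finally show ?thesis .
qed

text \<open>This is \<open>3 * \<tau> + 4\<close> with the \<tau> of
  \<open>prob_deviation_set_le\<close>; it depends on neither \<open>N\<close> nor
  \<open>d\<close>.\<close>

definition discrepancy_constant :: "nat \<Rightarrow> real \<Rightarrow> real" where
  "discrepancy_constant q \<epsilon> = 9 * (4 * (3 + ln (real q)) + 4 + ln (8 * exp 2 / \<epsilon>)) + 4"

section \<open>Choice of the stopping level\<close>

context uniform_digits
begin

lemma measurable_digit_point:
  assumes "j \<in> {1..d}"
  shows "(\<lambda>\<omega>. digit_point \<omega> n j) \<in> borel_measurable M"
proof -
  have "(\<lambda>\<omega>. real (X j i \<omega>)) \<in> borel_measurable M" for i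
    by (rule measurable_compose[OF measurable_digit[OF assms]]) simp
  then show ?thesis
    unfolding digit_point_def by (intro borel_measurable_suminf borel_measurable_divide) auto
qed

lemma prob_discrepancy_ge:
  assumes d: "d \<ge> 2" and N: "N \<ge> 1" and \<epsilon>: "0 < \<epsilon>" "\<epsilon> < 1"
  shows "prob {\<omega> \<in> space M. \<forall>t\<in>{1..d} \<rightarrow>\<^sub>E {0..1}. box_deviation d N (digit_point \<omega>) t
      \<le> discrepancy_constant q \<epsilon> * sqrt (real d * ln (real d) / real N)} \<ge> 1 - \<epsilon>"
proof -
  define w where "w = sqrt (real d * ln (real d) / real N)"
  define \<tau> where "\<tau> = 3 * (4 * (3 + ln (real q)) + 4 + ln (8 * exp 2 / \<epsilon>))"
  have C: "discrepancy_constant q \<epsilon> = 3 * \<tau> + 4"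
    by (simp add: discrepancy_constant_def \<tau>_def)
  have w_pos: "w > 0"
    using d N by (simp add: w_def)
  have "1 \<le> exp (2 :: real)"
    by simp
  then have "1 \<le> 8 * exp 2 / \<epsilon>"
    using \<epsilon> by (simp only: pos_le_divide_eq)
  then have \<tau>: "\<tau> \<ge> 0"
    using q_ge_2 by (simp add: \<tau>_def)
  let ?S = "{\<omega> \<in> space M. \<forall>t\<in>{1..d} \<rightarrow>\<^sub>E {0..1}. box_deviation d N (digit_point \<omega>) t \<le> (3 * \<tau> + 4) * w}"
  have S: "?S \<in> events"
    by (rule box_deviation_event[OF measurable_digit_point])
  have "1 - \<epsilon> \<le> prob ?S"
  \<comment> \<open>If \<open>4 * w \<ge> 1\<close>, the claimed bound is at least 1 and holds for
    every box.\<close>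
  proof (cases "1 \<le> 4 * w")
    case True
    moreover have "0 \<le> 3 * \<tau> * w"
      using \<tau> w_pos by simp
    ultimately have "1 \<le> (3 * \<tau> + 4) * w"
      unfolding distrib_right by linarith
    then have "?S = space M"
      using box_deviation_le_1 order_trans by blast
    then show ?thesis
      using \<epsilon> by (simp add: prob_space)
  next
    case False
    \<comment> \<open>\<open>K = n - 1\<close> meets both demands: \<open>w * 4^K \<le> 1\<close>,
      by minimality, for the tail bounds, and \<open>w * 4^(K + 1) \<ge> 1\<close> for the rounding
      error. Since \<open>4 * w < 1\<close>, the chain has at least one level.\<close>
    define n where "n = (LEAST n. 1 \<le> w * 4 ^ n)"
    obtain n0 where "1 / w < 4 ^ n0"
      using real_arch_pow[of 4 "1 / w"] by auto
    then have "1 \<le> w * 4 ^ n0"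
      using w_pos by (simp add: field_simps)
    then have n: "1 \<le> w * 4 ^ n"
      unfolding n_def by (rule LeastI)
    have "n \<noteq> 0"
    proof
      assume "n = 0"
      then have "1 \<le> w"
        using n by simp
      then show False
        using False by linarith
    qed
    moreover have "n \<noteq> 1"
      using n False by (auto simp: mult.commute)
    ultimately have "n \<ge> 2"
      by linarith
    then obtain K where K: "n = K + 1" "K \<ge> 1"
      by (intro that[of "n - 1"]) auto
    have "\<not> 1 \<le> w * 4 ^ K"
      using not_less_Least[of K "\<lambda>n. 1 \<le> w * 4 ^ n"] K(1) by (simp add: n_def)
    then have wK: "w * 4 ^ K \<le> 1"
      by simp
    note dev = prob_deviation_set_le[OF d N w_def wK \<epsilon> \<tau>_def]
    have "1 - \<epsilon> \<le> 1 - prob (deviation_set N \<tau> w K)"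
      using dev(2) by simp
    also have "\<dots> = prob (space M - deviation_set N \<tau> w K)"
      by (rule prob_compl[OF dev(1), symmetric])
    also have "\<dots> \<le> prob ?S"
    proof (rule finite_measure_mono[OF _ S], safe)
      fix \<omega> and t :: "nat \<Rightarrow> real"
      assume \<omega>: "\<omega> \<in> space M" "\<omega> \<notin> deviation_set N \<tau> w K" and t: "t \<in> {1..d} \<rightarrow>\<^sub>E {0..1}"
      show "box_deviation d N (digit_point \<omega>) t \<le> (3 * \<tau> + 4) * w"
        unfolding box_deviation_def using n K t
        by (intro discrepancy_off_deviation_set[OF d N \<omega>] w_pos \<tau>) (auto simp: PiE_iff)
    qed
    finally show ?thesis .
  qed
  then show ?thesis
    by (simp only: C w_def)
qed

end

section \<open>Transfer to the Kronecker points and growth of the constant\<close>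

lemma star_discrepancy_kronecker_le_iff:
  fixes f :: "nat \<Rightarrow> 'q::prime_card mod_ring fls"
  shows "star_discrepancy d N (kronecker_point d f) \<le> c \<longleftrightarrow>
    (\<forall>t\<in>{1..d} \<rightarrow>\<^sub>E {0..1}. box_deviation d N (uniform_digits.digit_point CARD('q) haar_digit f) t \<le> c)"
proof -
  interpret uniform_digits "haar_product d :: (nat \<Rightarrow> 'q mod_ring fls) measure" d "CARD('q)" haar_digit
    by (rule uniform_digits_haar)
  have eq: "kronecker_point d f n j = digit_point f n j" if "j \<in> {1..d}" for n j
    using kronecker_point_eq[OF that, of f n] by (simp only: digit_point_def)
  have nonneg: "0 \<le> digit_point f n j" for n j
    unfolding digit_point_def
    by (intro suminf_nonneg summable_digits digit_less q_ge_2) auto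
  have "star_discrepancy d N (kronecker_point d f) \<le> c
      \<longleftrightarrow> (\<forall>t\<in>{1..d} \<rightarrow>\<^sub>E {0..1}. box_deviation d N (kronecker_point d f) t \<le> c)"
    using eq nonneg by (intro star_discrepancy_le_iff) (auto simp: kronecker_point_def)
  moreover have "box_deviation d N (kronecker_point d f) t = box_deviation d N (digit_point f) t" for t
    unfolding box_deviation_def by (simp only: eq cong: ball_cong)
  ultimately show ?thesis
    by (simp only:)
qed

text \<open>The constant is \<open>a + 9 * ln (1 / \<epsilon>)\<close> with
  \<open>a \<ge> 0\<close>; for \<open>\<epsilon> < exp (- 1)\<close> the logarithm is at least 1
  and absorbs \<open>a\<close>.\<close>

lemma discrepancy_constant_bigtheta:
  assumes "q \<ge> 1"
  shows "discrepancy_constant q \<in> \<Theta>[at_right 0](\<lambda>\<epsilon>. ln (1 / \<epsilon>))"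
proof -
  define a where "a = 9 * (4 * (3 + ln (real q)) + 4 + ln (8 * exp 2)) + 4"
  have "1 \<le> exp (2 :: real)"
    by simp
  then have "1 \<le> 8 * exp (2 :: real)"
    by linarith
  then have "0 \<le> ln (8 * exp (2 :: real))" "0 \<le> ln (real q)"
    using assms by (auto intro!: ln_ge_zero)
  then have a: "0 \<le> a"
    unfolding a_def by (intro add_nonneg_nonneg mult_nonneg_nonneg) auto
  have ev: "\<forall>\<^sub>F \<epsilon> in at_right 0. 1 \<le> ln (1 / \<epsilon>) \<and> discrepancy_constant q \<epsilon> = a + 9 * ln (1 / \<epsilon>)"
  proof (rule eventually_at_rightI[of 0 "exp (- 1)"])
    fix \<epsilon> :: real
    assume "\<epsilon> \<in> {0<..<exp (- 1)}"
    then have \<epsilon>: "0 < \<epsilon>" "\<epsilon> < exp (- 1)"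
      by auto
    then have "ln \<epsilon> < ln (exp (- 1))"
      by (subst ln_less_cancel_iff) auto
    moreover have "ln (8 * exp 2 / \<epsilon>) = ln (8 * exp 2) - ln \<epsilon>" "ln (1 / \<epsilon>) = - ln \<epsilon>"
      using \<epsilon>(1) by (simp_all add: ln_div)
    ultimately show "1 \<le> ln (1 / \<epsilon>) \<and> discrepancy_constant q \<epsilon> = a + 9 * ln (1 / \<epsilon>)"
      by (simp add: discrepancy_constant_def a_def)
  qed simp
  show ?thesis
  proof (rule bigthetaI)
    show "discrepancy_constant q \<in> O[at_right 0](\<lambda>\<epsilon>. ln (1 / \<epsilon>))"
    proof (rule landau_o.bigI[of "a + 9"])
      show "\<forall>\<^sub>F \<epsilon> in at_right 0. norm (discrepancy_constant q \<epsilon>) \<le> (a + 9) * norm (ln (1 / \<epsilon>))"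
        using ev
      proof (rule eventually_mono)
        fix \<epsilon> :: real
        assume *: "1 \<le> ln (1 / \<epsilon>) \<and> discrepancy_constant q \<epsilon> = a + 9 * ln (1 / \<epsilon>)"
        then have "a * 1 \<le> a * ln (1 / \<epsilon>)"
          using a by (intro mult_left_mono) auto
        then show "norm (discrepancy_constant q \<epsilon>) \<le> (a + 9) * norm (ln (1 / \<epsilon>))"
          using * a by (simp add: distrib_right)
      qed
    qed (use a in simp)
    show "discrepancy_constant q \<in> \<Omega>[at_right 0](\<lambda>\<epsilon>. ln (1 / \<epsilon>))"
    proof (rule landau_omega.bigI[of 9])
      show "\<forall>\<^sub>F \<epsilon> in at_right 0. 9 * norm (ln (1 / \<epsilon>)) \<le> norm (discrepancy_constant q \<epsilon>)"
        using ev by (rule eventually_mono) (use a in simp)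
    qed simp
  qed
qed

lemma discrepancy_constant_pos:
  assumes "q \<ge> 1" "0 < \<epsilon>" "\<epsilon> < 1"
  shows "discrepancy_constant q \<epsilon> > 0"
proof -
  have "1 \<le> exp (2 :: real)"
    by simp
  then have "1 \<le> 8 * exp 2 / \<epsilon>"
    using assms by (simp only: pos_le_divide_eq)
  then have "0 \<le> ln (8 * exp 2 / \<epsilon>)" "0 \<le> ln (real q)"
    using assms by simp_all
  moreover have "0 < 9 * (4 * (3 + a) + 4 + b) + 4" if "0 \<le> a" "0 \<le> b" for a b :: real
    using that by (intro add_nonneg_pos mult_nonneg_nonneg add_nonneg_nonneg) auto
  ultimately show ?thesis
    unfolding discrepancy_constant_def by blast
qed

theorem theorem2:
  shows "\<exists>C :: real \<Rightarrow> real.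
    (\<forall>\<epsilon>\<in>{0<..<1}. C \<epsilon> > 0) \<and>
    C \<in> \<Theta>[at_right 0](\<lambda>\<epsilon>. ln (1 / \<epsilon>)) \<and>
    (\<forall>N\<ge>2. \<forall>d\<ge>2. \<forall>\<epsilon>\<in>{0<..<1}.
       let \<mu>\<^sub>d = (\<Pi>\<^sub>M j\<in>{1..d}. (frac_haar :: 'q::prime_card mod_ring fls measure)) in
       measure \<mu>\<^sub>d {f \<in> space \<mu>\<^sub>d.
         star_discrepancy d N (kronecker_point d f) \<le> C \<epsilon> * sqrt (real d * ln (real d) / real N)}
       \<ge> 1 - \<epsilon>)"
proof (intro exI[of _ "discrepancy_constant CARD('q)"] conjI ballI allI impI)
  show "discrepancy_constant CARD('q) \<epsilon> > 0" if "\<epsilon> \<in> {0<..<1}" for \<epsilon>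
    using that by (intro discrepancy_constant_pos) (auto simp: Suc_le_eq)
  show "discrepancy_constant CARD('q) \<in> \<Theta>[at_right 0](\<lambda>\<epsilon>. ln (1 / \<epsilon>))"
    by (rule discrepancy_constant_bigtheta) (simp add: Suc_le_eq)
  fix N d :: nat and \<epsilon> :: real
  assume "N \<ge> 2" "d \<ge> 2" "\<epsilon> \<in> {0<..<1}"
  then show "let \<mu>\<^sub>d = (\<Pi>\<^sub>M j\<in>{1..d}. (frac_haar :: 'q mod_ring fls measure)) in
       measure \<mu>\<^sub>d {f \<in> space \<mu>\<^sub>d.
         star_discrepancy d N (kronecker_point d f) \<le> discrepancy_constant CARD('q) \<epsilon> * sqrt (real d * ln (real d) / real N)}
       \<ge> 1 - \<epsilon>"
    unfolding Let_def star_discrepancy_kronecker_le_iff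
    by (intro uniform_digits.prob_discrepancy_ge[OF uniform_digits_haar]) auto
qed

end
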